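(* Let $G$ be a grid diagram of index $n$ on a torus $T$ representing a knot $K$, let $\mathcal{G}$ be the associated grid poset, and let $l\subset T$ be a circle which is disjoint from all the $\beta$ circles and intersects each $\alpha$ circle exactly once. Let $x,y\in\mathcal{G}$. Then the map which sends a covering relation represented by an empty rectangle $R$ to the triple $(s(R),i(R),t(R))$ (triples being ordered lexicographically) induces an EL-shelling on the closed interval $[y,x]=\{z\in\mathcal{G}\mid y\preceq z\preceq x\}$.
   Context: **Grid diagrams.** A grid diagram of index $n$ consists of an oriented torus $T$ (drawn as a square with opposite sides identified, with horizontal and vertical directions, and with the usual planar orientation) with $n$ pairwise disjoint parallel horizontal circles, the $\alpha$ circles, cutting $T$ into $n$ horizontal annuli, and $n$ pairwise disjoint parallel vertical circles, the $\beta$ circles, cutting $T$ into $n$ vertical annuli, such that each $\alpha$ circle meets each $\beta$ circle exactly once (so $T\setminus(\alpha\cup\beta)$ has $n^2$ components); together with $2n$ markings $X_1,\dots,X_n,O_1,\dots,O_n$ in $T\setminus(\alpha\cup\beta)$ such that each horizontal annulus contains exactly one $X$ and one $O$ marking, namely $X_i$ and $O_i$ for some $i$, and each vertical annulus contains exactly one $O$ and one $X$ marking, namely $O_i$ and $X_{i+1}$ for some $i$ (indices modulo $n$). The knot $K$ is obtained by embedding $T$ in a standard way in $\mathbb{R}^3$ and joining $X_i$ to $O_i$ in the horizontal annuli inside $T$ and $O_i$ to $X_{i+1}$ in the vertical annuli outside $T$. **Generators.** A generator is a formal sum $\widetilde{x}=x_1+\cdots+x_n$ of $n$ points of $\alpha\cap\beta$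 such that each $\alpha$ circle contains exactly one of the points and each $\beta$ circle contains exactly one of the points; the $x_i$ are called the $\widetilde{x}$-coordinates. The set of $n!$ generators is $\widetilde{\mathcal{G}}$. The set $\mathcal{G}$ consists of the formal expressions $x=\widetilde{x}\prod_{i=1}^n U_i^{k_i}$ with $\widetilde{x}\in\widetilde{\mathcal{G}}$ and $k_i\in\mathbb{Z}_{\ge 0}$. **Domains.** A domain connecting $\widetilde{x}$ to $\widetilde{y}$ is a $2$-chain $D$, i.e. an integer linear combination of the components of $T\setminus(\alpha\cup\beta)$, with $\partial(\partial D|_\alpha)=\widetilde{y}-\widetilde{x}$; the set of these is $\mathcal{D}(\widetilde{x},\widetilde{y})$. For $p\in T\setminus(\alpha\cup\beta)$, $n_p(D)$ is the coefficient of $D$ at $p$; $D$ is positive if $n_p(D)\ge 0$ for all $p$. For $x=\widetilde{x}\prod_i U_i^{k_i}$ and $y=\widetilde{y}\prod_i U_i^{l_i}$ in $\mathcal{G}$, $\mathcal{D}(x,y)$ is the set of $D\in\mathcal{D}(\widetilde{x},\widetilde{y})$ with $n_{O_i}(D)=l_i-k_i$ and $n_{X_i}(D)=0$ for all $i$; this set has at most one element. **Empty rectangles.** $R\in\mathcal{D}(\widetilde{x},\widetilde{y})$ is an empty rectangle if its coefficients are all $0$ or $1$ and the closure of the region where it has coefficient $1$ is a rectangle containing no $\widetilde{x}$-coordinate and no $\widetilde{y}$-coordinate in its interior. The set of these is $\mathcal{R}(\widetilde{x},\widetilde{y})$, and $\mathcal{R}(x,y)=\mathcal{R}(\widetilde{x},\widetilde{y})\cap\mathcal{D}(x,y)$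 for $x,y\in\mathcal{G}$. **The grid poset.** The partial order on $\mathcal{G}$ is: $y\preceq x$ if and only if there is a positive domain in $\mathcal{D}(x,y)$. An element $b$ covers $a$, written $a\leftarrow b$, if $a\prec b$ and there is no $z$ with $a\prec z\prec b$. The covering relations $y\leftarrow x$ in $\mathcal{G}$ are indexed by the elements of $\mathcal{R}(x,y)$: $y\leftarrow x$ if and only if $\mathcal{R}(x,y)\neq\varnothing$, in which case it consists of a unique empty rectangle $R$, which is said to represent the covering relation. **The triple.** For an empty rectangle $R\in\mathcal{R}(x,y)$: $s(R)=0$ if $R$ intersects $l$ and $s(R)=1$ otherwise. If $s(R)=0$, $i(R)$ is the minimum number of $\beta$ circles one has to cross to travel from $l$ to the leftmost (vertical) arc of $R$, going left throughout; if $s(R)=1$, $i(R)$ is the minimum number of $\beta$ circles one has to cross to travel from $l$ to the leftmost arc of $R$, going right throughout; in both cases the $\beta$ circle containing the leftmost arc of $R$ is included in the count. $t(R)$ is the thickness of $R$, i.e. the number of vertical annuli that $R$ hits. **EL-shellings.** The length of a chain is its cardinality. A poset is graded if in every interval all maximal chains have the same length. A graded poset is EL-shellable (edge-lexicographically shellable), with EL-shelling $f$, if $f$ is a map from the set of its covering relations to a totally ordered set such that for every closed interval $[x_1,x_m]$ of length $m$, if to each maximal chain $x_1\leftarrow x_2\leftarrow\cdots\leftarrow x_m$ one associates the labeling $(f(x_1\leftarrow x_2),\dots,f(x_{m-1}\leftarrow x_m))$, then there is a unique maximal chain whose labeling is increasing (each entry is $\le$ the next), and the labeling of that chain is lexicographically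 the smallest among the labelings of all maximal chains between $x_1$ and $x_m$. *)

theory Defs
  imports Main "HOL-Library.Product_Lexorder" "HOL-Library.List_Lexorder"
begin

section \<open>EL-shellings\<close>

text \<open>Posets are given by a carrier \<open>P\<close> and a relation \<open>le\<close>.\<close>

definition closed_interval :: "'a set \<Rightarrow> ('a \<Rightarrow> 'a \<Rightarrow> bool) \<Rightarrow> 'a \<Rightarrow> 'a \<Rightarrow> 'a set" where
  "closed_interval P le a b = {z \<in> P. le a z \<and> le z b}"

definition covered_by :: "'a set \<Rightarrow> ('a \<Rightarrow> 'a \<Rightarrow> bool) \<Rightarrow> 'a \<Rightarrow> 'a \<Rightarrow> bool" where
  "covered_by P le a b \<longleftrightarrow> a \<in> P \<and> b \<in> P \<and> le a b \<and> a \<noteq> b \<and>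
     \<not> (\<exists>z\<in>P. le a z \<and> a \<noteq> z \<and> le z b \<and> z \<noteq> b)"

definition graded_poset :: "'a set \<Rightarrow> ('a \<Rightarrow> 'a \<Rightarrow> bool) \<Rightarrow> bool" where
  "graded_poset P le \<longleftrightarrow> partial_order_on P (relation_of le P) \<and>
     (\<forall>a\<in>P. \<forall>b\<in>P. le a b \<longrightarrow>
        (\<exists>m. \<forall>C. pred_on.maxchain (closed_interval P le a b) le C \<longrightarrow> finite C \<and> card C = m))"

text \<open>
  In a graded poset, where maximal chains of intervals are finite, the lists below are exactly
  the increasing enumerations of the maximal chains of the interval from \<open>a\<close> to \<open>b\<close>.
\<close>

definition maximal_chains :: "'a set \<Rightarrow> ('a \<Rightarrow> 'a \<Rightarrow> bool) \<Rightarrow> 'a \<Rightarrow> 'a \<Rightarrow> 'a list set" where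
  "maximal_chains P le a b =
     {xs. xs \<noteq> [] \<and> hd xs = a \<and> last xs = b \<and> successively (covered_by P le) xs}"

definition labeling :: "('a \<Rightarrow> 'a \<Rightarrow> 'l) \<Rightarrow> 'a list \<Rightarrow> 'l list" where
  "labeling f xs = map2 f (butlast xs) (tl xs)"

text \<open>
  Only the values \<open>f a b\<close> with \<open>a\<close> covered by \<open>b\<close> matter. Labelings are compared in the
  lexicographic order of \<^theory>\<open>HOL-Library.List_Lexorder\<close>.
\<close>

definition EL_shelling :: "'a set \<Rightarrow> ('a \<Rightarrow> 'a \<Rightarrow> bool) \<Rightarrow> ('a \<Rightarrow> 'a \<Rightarrow> 'l::linorder) \<Rightarrow> bool" where
  "EL_shelling P le f \<longleftrightarrow> graded_poset P le \<and>
     (\<forall>a\<in>P. \<forall>b\<in>P. le a b \<longrightarrow>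
        (\<exists>c \<in> maximal_chains P le a b.
           sorted (labeling f c) \<and>
           (\<forall>d \<in> maximal_chains P le a b. sorted (labeling f d) \<longrightarrow> d = c) \<and>
           (\<forall>d \<in> maximal_chains P le a b. labeling f c \<le> labeling f d)))"


section \<open>Grid diagrams\<close>

text \<open>
  All indices are residues \<open>0, \<dots>, n - 1\<close>, taken modulo \<open>n\<close>. The vertical circles
  \<open>\<beta>\<^sub>0, \<dots>, \<beta>\<^sub>n\<^sub>-\<^sub>1\<close> are numbered from left to right and the horizontal circles
  \<open>\<alpha>\<^sub>0, \<dots>, \<alpha>\<^sub>n\<^sub>-\<^sub>1\<close> from bottom to top. The pair \<open>(i, j)\<close> denotes either the point
  \<open>\<beta>\<^sub>i \<inter> \<alpha>\<^sub>j\<close> or the component of the complement of the circles whose lower left corner is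
  that point. Thus vertical annulus \<open>i\<close> lies between \<open>\<beta>\<^sub>i\<close> and \<open>\<beta>\<^sub>i\<^sub>+\<^sub>1\<close>, and horizontal
  annulus \<open>j\<close> between \<open>\<alpha>\<^sub>j\<close> and \<open>\<alpha>\<^sub>j\<^sub>+\<^sub>1\<close>.
\<close>

definition torus_grid :: "nat \<Rightarrow> (nat \<times> nat) set" where
  "torus_grid n = {..<n} \<times> {..<n}"

definition grid_diagram :: "nat \<Rightarrow> (nat \<Rightarrow> nat \<times> nat) \<Rightarrow> (nat \<Rightarrow> nat \<times> nat) \<Rightarrow> bool" where
  "grid_diagram n Xs Os \<longleftrightarrow> n \<ge> 1 \<and>
     (\<forall>i<n. Xs i \<in> torus_grid n \<and> Os i \<in> torus_grid n) \<and>
     (\<forall>r<n. \<exists>i<n. {k. k < n \<and> snd (Xs k) = r} = {i} \<and> {k. k < n \<and> snd (Os k) = r} = {i}) \<and>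
     (\<forall>c<n. \<exists>i<n. {k. k < n \<and> fst (Os k) = c} = {i} \<and>
                  {k. k < n \<and> fst (Xs k) = c} = {(i + 1) mod n})"

text \<open>A formal sum of intersection points with coefficients 0 and 1 is encoded as a set.\<close>

definition generators :: "nat \<Rightarrow> (nat \<times> nat) set set" where
  "generators n = {S. S \<subseteq> torus_grid n \<and>
     (\<forall>i<n. \<exists>!p. p \<in> S \<and> fst p = i) \<and> (\<forall>j<n. \<exists>!p. p \<in> S \<and> snd p = j)}"

text \<open>The pair \<open>(S, k)\<close> stands for the generator \<open>S\<close> times the product of the \<open>U\<^sub>i\<close> to the \<open>k i\<close>.\<close>

type_synonym grid_element = "(nat \<times> nat) set \<times> (nat \<Rightarrow> nat)"

definition grid_elements :: "nat \<Rightarrow> grid_element set" where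
  "grid_elements n = {(S, k). S \<in> generators n \<and> (\<forall>i\<ge>n. k i = 0)}"

type_synonym two_chain = "nat \<times> nat \<Rightarrow> int"

definition two_chains :: "nat \<Rightarrow> two_chain set" where
  "two_chains n = {D. \<forall>p. p \<notin> torus_grid n \<longrightarrow> D p = 0}"

text \<open>
  \<open>alpha_boundary n D (i, j)\<close> is the coefficient in the boundary of \<open>D\<close> of the arc of \<open>\<alpha>\<^sub>j\<close>
  running rightwards from \<open>(i, j)\<close> to \<open>(i + 1, j)\<close>: with the planar orientation, the component
  above this arc contributes positively and the one below negatively. Applying
  \<open>arcs_boundary\<close> to these coefficients takes the endpoint minus the starting point of each arc.
\<close>

definition alpha_boundary :: "nat \<Rightarrow> two_chain \<Rightarrow> nat \<times> nat \<Rightarrow> int" where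
  "alpha_boundary n D = (\<lambda>(i, j). D (i, j) - D (i, (j + n - 1) mod n))"

definition arcs_boundary :: "nat \<Rightarrow> (nat \<times> nat \<Rightarrow> int) \<Rightarrow> nat \<times> nat \<Rightarrow> int" where
  "arcs_boundary n E = (\<lambda>(i, j). E ((i + n - 1) mod n, j) - E (i, j))"

definition domains :: "nat \<Rightarrow> (nat \<times> nat) set \<Rightarrow> (nat \<times> nat) set \<Rightarrow> two_chain set" where
  "domains n S T = {D \<in> two_chains n. \<forall>p \<in> torus_grid n.
     arcs_boundary n (alpha_boundary n D) p = of_bool (p \<in> T) - of_bool (p \<in> S)}"

definition element_domains ::
  "nat \<Rightarrow> (nat \<Rightarrow> nat \<times> nat) \<Rightarrow> (nat \<Rightarrow> nat \<times> nat) \<Rightarrow> grid_element \<Rightarrow> grid_element \<Rightarrow> two_chain set" where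
  "element_domains n Xs Os x y = {D \<in> domains n (fst x) (fst y).
     \<forall>i<n. D (Os i) = int (snd y i) - int (snd x i) \<and> D (Xs i) = 0}"

definition positive_chain :: "nat \<Rightarrow> two_chain \<Rightarrow> bool" where
  "positive_chain n D \<longleftrightarrow> (\<forall>p \<in> torus_grid n. D p \<ge> 0)"

text \<open>\<open>grid_le n Xs Os y x\<close> means that \<open>y\<close> is below \<open>x\<close>; the domain goes from \<open>x\<close> to \<open>y\<close>.\<close>

definition grid_le ::
  "nat \<Rightarrow> (nat \<Rightarrow> nat \<times> nat) \<Rightarrow> (nat \<Rightarrow> nat \<times> nat) \<Rightarrow> grid_element \<Rightarrow> grid_element \<Rightarrow> bool" where
  "grid_le n Xs Os y x \<longleftrightarrow> (\<exists>D \<in> element_domains n Xs Os x y. positive_chain n D)"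


section \<open>Empty rectangles and their labels\<close>

text \<open>
  The components and the interior points of the block with lower left corner \<open>(a, b)\<close>, width \<open>w\<close>
  and height \<open>h\<close>. The closure of the block is an embedded rectangle (rather than an annulus or
  the torus) if and only if \<open>0 < w < n\<close> and \<open>0 < h < n\<close>.
\<close>

definition block_components :: "nat \<Rightarrow> nat \<Rightarrow> nat \<Rightarrow> nat \<Rightarrow> nat \<Rightarrow> (nat \<times> nat) set" where
  "block_components n a b w h = {((a + s) mod n, (b + t) mod n) | s t. s < w \<and> t < h}"

definition block_interior_points :: "nat \<Rightarrow> nat \<Rightarrow> nat \<Rightarrow> nat \<Rightarrow> nat \<Rightarrow> (nat \<times> nat) set" where
  "block_interior_points n a b w h =
     {((a + s) mod n, (b + t) mod n) | s t. 0 < s \<and> s < w \<and> 0 < t \<and> t < h}"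

definition empty_rectangles :: "nat \<Rightarrow> (nat \<times> nat) set \<Rightarrow> (nat \<times> nat) set \<Rightarrow> two_chain set" where
  "empty_rectangles n S T = {R \<in> domains n S T. (\<forall>p. R p \<in> {0, 1}) \<and>
     (\<exists>a<n. \<exists>b<n. \<exists>w h. 0 < w \<and> w < n \<and> 0 < h \<and> h < n \<and>
        {p. R p = 1} = block_components n a b w h \<and>
        block_interior_points n a b w h \<inter> (S \<union> T) = {})}"

definition element_rectangles ::
  "nat \<Rightarrow> (nat \<Rightarrow> nat \<times> nat) \<Rightarrow> (nat \<Rightarrow> nat \<times> nat) \<Rightarrow> grid_element \<Rightarrow> grid_element \<Rightarrow> two_chain set" where
  "element_rectangles n Xs Os x y =
     empty_rectangles n (fst x) (fst y) \<inter> element_domains n Xs Os x y"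

definition hit_annuli :: "nat \<Rightarrow> two_chain \<Rightarrow> nat set" where
  "hit_annuli n R = {i. i < n \<and> (\<exists>j<n. R (i, j) \<noteq> 0)}"

text \<open>The index of the \<open>\<beta>\<close> circle containing the leftmost arc of a rectangle.\<close>

definition left_beta :: "nat \<Rightarrow> two_chain \<Rightarrow> nat" where
  "left_beta n R = (THE a. a \<in> hit_annuli n R \<and> (a + n - 1) mod n \<notin> hit_annuli n R)"

text \<open>
  A circle \<open>l\<close> that is disjoint from the \<open>\<beta>\<close> circles and crosses each \<open>\<alpha>\<close> circle once runs
  through all components of a single vertical annulus, and enters below only through the index
  \<open>l\<close> of that annulus. Going left from \<open>l\<close>, the \<open>k\<close>-th \<open>\<beta>\<close> circle crossed is
  \<open>\<beta>\<^sub>l\<^sub>+\<^sub>1\<^sub>-\<^sub>k\<close>; going right, it is \<open>\<beta>\<^sub>l\<^sub>+\<^sub>k\<close>.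
\<close>

definition rect_s :: "nat \<Rightarrow> nat \<Rightarrow> two_chain \<Rightarrow> nat" where
  "rect_s n l R = (if l \<in> hit_annuli n R then 0 else 1)"

definition rect_i :: "nat \<Rightarrow> nat \<Rightarrow> two_chain \<Rightarrow> nat" where
  "rect_i n l R =
     (if rect_s n l R = 0
      then (LEAST k. 1 \<le> k \<and> (left_beta n R + k) mod n = (l + 1) mod n)
      else (LEAST k. 1 \<le> k \<and> (l + k) mod n = left_beta n R))"

definition rect_t :: "nat \<Rightarrow> two_chain \<Rightarrow> nat" where
  "rect_t n R = card (hit_annuli n R)"

text \<open>Triples are ordered as in \<^theory>\<open>HOL-Library.Product_Lexorder\<close>.\<close>

definition rect_triple :: "nat \<Rightarrow> nat \<Rightarrow> two_chain \<Rightarrow> nat \<times> nat \<times> nat" where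
  "rect_triple n l R = (rect_s n l R, rect_i n l R, rect_t n R)"

definition cover_label ::
  "nat \<Rightarrow> (nat \<Rightarrow> nat \<times> nat) \<Rightarrow> (nat \<Rightarrow> nat \<times> nat) \<Rightarrow> nat \<Rightarrow> grid_element \<Rightarrow> grid_element \<Rightarrow>
    nat \<times> nat \<times> nat" where
  "cover_label n Xs Os l y x = rect_triple n l (THE R. R \<in> element_rectangles n Xs Os x y)"

end

(*
  A generator is a permutation s (column to row), and an empty rectangle going down to it is an
  ordered pair of columns (a, b): it has (a, s a) as upper left and (b, s b) as lower right corner.
  Cutting off rectangles shows that these are exactly the covering relations, and a discrete
  Lipshitz index (the sum of the coefficients next to the coordinates of both generators) equals 4
  on rectangles and is additive, which makes the poset graded.

  Take the chain which always goes up along the least label. If the next label were smaller than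
  the present one, the union of the two rectangles, possibly L-shaped, could be cut the other way,
  giving a smaller label to start with; so this chain is increasing. Conversely, an increasing
  chain has to start with the least label: otherwise all its rectangles together would miss a
  square of the rectangle with the least label.
*)

theory Submission
  imports Defs
begin

section \<open>Abstract criterion: a rank function and three conditions on labels\<close>

section \<open>EL-shellings from local conditions\<close>

text \<open>Two effects of the markings shape the proof. They make domains unique, so membership in
  \<open>[y, x]\<close> becomes a cellwise comparison: a vacant rectangle can come first above
  \<open>y\<close> exactly when it fits under the single domain from \<open>x\<close> to
  \<open>y\<close>. And every annulus contains an X, where all domains vanish, so no domain fills an
  annulus. This gives the zeros from which a rectangle in a positive domain is found, and it
  excludes two successive rectangles on the same pair of columns, the only case in which their union
  cannot be recut. The index needs no Euler measure, because square tiles have Euler measure 0; the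
  value 4 instead of 1 avoids the fractions 1/4 at corners, and additivity is the symmetry of a
  bilinear form. The missed square is sought in one fixed column: \<open>l\<close> if the rectangle
  with the least label crosses it, otherwise the left column of that rectangle. A sorted chain
  passes through stages recognizable from \<open>s\<close> and \<open>i\<close>, which together
  leave a square of this column uncovered within the rows of the rectangle.\<close>

locale ranked_poset =
  fixes P :: "'a set" and le :: "'a \<Rightarrow> 'a \<Rightarrow> bool" and rk :: "'a \<Rightarrow> 'a \<Rightarrow> nat"
  assumes le_refl: "a \<in> P \<Longrightarrow> le a a"
    and le_trans: "\<lbrakk>a \<in> P; b \<in> P; c \<in> P; le a b; le b c\<rbrakk> \<Longrightarrow> le a c"
    and le_antisym: "\<lbrakk>a \<in> P; b \<in> P; le a b; le b a\<rbrakk> \<Longrightarrow> a = b"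
    and rk_add: "\<lbrakk>a \<in> P; b \<in> P; c \<in> P; le a b; le b c\<rbrakk> \<Longrightarrow> rk a c = rk a b + rk b c"
    and rk_eq_0: "\<lbrakk>a \<in> P; b \<in> P; le a b; rk a b = 0\<rbrakk> \<Longrightarrow> a = b"
    and rk_between: "\<lbrakk>a \<in> P; b \<in> P; le a b; 2 \<le> rk a b\<rbrakk> \<Longrightarrow>
      \<exists>z\<in>P. le a z \<and> le z b \<and> z \<noteq> a \<and> z \<noteq> b"
begin

lemma partial_order: "partial_order_on P (relation_of le P)"
  by (rule partial_order_on_relation_ofI) (auto intro: le_refl le_trans le_antisym)

lemma rk_le_between:
  assumes "a \<in> P" "b \<in> P" "le a b" "2 \<le> rk a b"
  obtains z where "z \<in> P" "le a z" "le z b" "0 < rk a z" "rk a z < rk a b"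
proof -
  obtain z where z: "z \<in> P" "le a z" "le z b" "z \<noteq> a" "z \<noteq> b"
    using rk_between[OF assms] by blast
  then have "rk a z \<noteq> 0" "rk z b \<noteq> 0"
    using rk_eq_0[of a z] rk_eq_0[of z b] assms by auto
  then show ?thesis
    using that[of z] z rk_add[of a z b] assms by auto
qed

text \<open>The map \<open>rk a\<close> is injective on a chain. If it skipped a value on a maximal
  chain, the neighbours \<open>p\<close>, \<open>q\<close> of the gap would have rank difference at
  least 2, and an element between them from \<open>rk_between\<close> could be added. So the image
  is all of \<open>{..rk a b}\<close>.\<close>

lemma card_maxchain:
  assumes aP: "a \<in> P" and bP: "b \<in> P" and ab: "le a b"
    and C: "pred_on.maxchain (closed_interval P le a b) le C"
  shows "finite C \<and> card C = Suc (rk a b)"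
proof -
  let ?I = "closed_interval P le a b"
  have chC: "pred_on.chain ?I le C"
    using C by (simp add: pred_on.maxchain_def)
  have sub: "C \<subseteq> ?I" and tot: "\<And>u v. u \<in> C \<Longrightarrow> v \<in> C \<Longrightarrow> le u v \<or> le v u"
    using chC le_refl by (auto simp: pred_on.chain_def closed_interval_def)
  have I: "z \<in> P \<and> le a z \<and> le z b" if "z \<in> C" for z
    using sub that by (auto simp: closed_interval_def)
  have maximal: "z \<in> C" if "z \<in> ?I" "\<And>u. u \<in> C \<Longrightarrow> le u z \<or> le z u" for z
  proof (rule ccontr)
    assume "z \<notin> C"
    moreover have "pred_on.chain ?I le (insert z C)"
      using sub tot that le_refl by (auto simp: pred_on.chain_def)
    ultimately show False
      using C by (auto simp: pred_on.maxchain_def)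
  qed
  have aC: "a \<in> C" and bC: "b \<in> C"
    using I aP bP ab le_refl by (auto intro!: maximal simp: closed_interval_def)
  have mono: "rk a v = rk a u + rk u v" if "u \<in> C" "v \<in> C" "le u v" for u v
    using rk_add[of a u v] I that aP by auto
  have rk_aa: "rk a a = 0"
    using rk_add[of a a a] le_refl aP by simp
  have le_rk: "le u v" if "u \<in> C" "v \<in> C" "rk a u < rk a v" for u v
    using tot[OF that(1,2)] mono[OF that(2,1)] that(3) by auto
  have inj: "inj_on (rk a) C"
  proof (rule inj_onI)
    fix u v assume uv: "u \<in> C" "v \<in> C" "rk a u = rk a v"
    from tot[OF uv(1,2)] show "u = v"
      using mono[of u v] mono[of v u] uv rk_eq_0[of u v] rk_eq_0[of v u] I by auto
  qed
  have "rk a ` C = {..rk a b}"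
  proof (intro equalityI subsetI)
    fix k assume "k \<in> rk a ` C"
    then show "k \<in> {..rk a b}"
      using mono[OF _ bC] I by force
  next
    fix k assume k: "k \<in> {..rk a b}"
    show "k \<in> rk a ` C"
    proof (rule ccontr)
      assume nk: "k \<notin> rk a ` C"
      have "rk a a < k" "k < rk a b"
        using nk aC bC k rk_aa by (metis imageI neq0_conv, metis atMost_iff imageI le_neq_implies_less)
      obtain p where p: "p \<in> C" "rk a p < k"
        and pmax: "\<And>u. u \<in> C \<Longrightarrow> rk a u < k \<Longrightarrow> rk a u \<le> rk a p"
        using ex_has_greatest_nat[of "\<lambda>u. u \<in> C \<and> rk a u < k" a "rk a" k] aC \<open>rk a a < k\<close> by auto
      obtain q where q: "q \<in> C" "k < rk a q"
        and qmin: "\<And>u. u \<in> C \<Longrightarrow> k < rk a u \<Longrightarrow> rk a q \<le> rk a u"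
        using ex_has_least_nat[of "\<lambda>u. u \<in> C \<and> k < rk a u" b "rk a"] bC \<open>k < rk a b\<close> by auto
      have pq: "le p q" using le_rk p q by auto
      have "2 \<le> rk p q" using mono[OF p(1) q(1) pq] p q by auto
      then obtain z where z: "z \<in> P" "le p z" "le z q" "0 < rk p z" "rk p z < rk p q"
        using rk_le_between[of p q] I p q pq by blast
      have az: "rk a z = rk a p + rk p z"
        using rk_add[of a p z] I[OF p(1)] z aP by auto
      have "z \<in> C"
      proof (rule maximal)
        show "z \<in> ?I"
          using z I[OF p(1)] I[OF q(1)] le_trans[of a p z] le_trans[of z q b] aP bP
          by (auto simp: closed_interval_def)
        fix u assume u: "u \<in> C"
        have "rk a u \<noteq> k" using nk u by auto
        then consider "rk a u \<le> rk a p" | "rk a q \<le> rk a u"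
          using pmax[OF u] qmin[OF u] by linarith
        then show "le u z \<or> le z u"
        proof cases
          case 1
          then have "le u p"
            using le_rk[OF u p(1)] inj_onD[OF inj _ u p(1)] le_refl I[OF u]
            by (cases "rk a u = rk a p") auto
          then show ?thesis using le_trans[of u p z] I[OF u] I[OF p(1)] z by auto
        next
          case 2
          then have "le q u"
            using le_rk[OF q(1) u] inj_onD[OF inj _ q(1) u] le_refl I[OF u]
            by (cases "rk a u = rk a q") auto
          then show ?thesis using le_trans[of z q u] I[OF u] I[OF q(1)] z by auto
        qed
      qed
      then show False
        using pmax[of z] qmin[of z] az z(4,5) mono[OF p(1) q(1) pq] nk
        by (metis add_less_cancel_left imageI less_add_same_cancel1 linorder_neqE_nat not_le)
    qed
  qed
  then show ?thesis
    using inj by (metis card_atMost card_image finite_atMost finite_imageD)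
qed

lemma graded: "graded_poset P le"
  unfolding graded_poset_def using partial_order card_maxchain by blast

lemma covered_by_below:
  assumes "a \<in> P" "b \<in> P" "le a b" "a \<noteq> b"
  obtains z where "covered_by P le a z" "le z b"
proof -
  obtain z where z: "z \<in> P" "le a z" "le z b" "a \<noteq> z"
    and min: "\<And>u. u \<in> P \<Longrightarrow> le a u \<Longrightarrow> le u b \<Longrightarrow> a \<noteq> u \<Longrightarrow> rk a z \<le> rk a u"
    using ex_has_least_nat[of "\<lambda>z. z \<in> P \<and> le a z \<and> le z b \<and> a \<noteq> z" b "rk a"] assms le_refl
    by blast
  have "covered_by P le a z"
    unfolding covered_by_def
  proof (intro conjI notI)
    assume "\<exists>u\<in>P. le a u \<and> a \<noteq> u \<and> le u z \<and> u \<noteq> z"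
    then obtain u where u: "u \<in> P" "le a u" "a \<noteq> u" "le u z" "u \<noteq> z" by blast
    then have "rk a z \<le> rk a u" using min le_trans[of u z b] z assms by blast
    then show False using rk_add[of a u z] rk_eq_0[of u z] u z assms by auto
  qed (use z assms in auto)
  then show ?thesis using that z by blast
qed

lemma labeling_Cons: "labeling f (a # z # c) = f a z # labeling f (z # c)"
  by (simp add: labeling_def)

lemma maximal_chains_Cons:
  "a # z # c \<in> maximal_chains P le a b \<longleftrightarrow>
    covered_by P le a z \<and> z # c \<in> maximal_chains P le z b"
  by (auto simp: maximal_chains_def)

lemma maximal_chains_le:
  "\<lbrakk>c \<in> maximal_chains P le a b; a \<in> P\<rbrakk> \<Longrightarrow> le a b \<and> b \<in> P"
proof (induction c arbitrary: a)
  case Nil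
  then show ?case by (simp add: maximal_chains_def)
next
  case (Cons u c)
  then have [simp]: "u = a" by (simp add: maximal_chains_def)
  show ?case
  proof (cases c)
    case Nil
    then show ?thesis using Cons.prems le_refl by (simp add: maximal_chains_def)
  next
    case (Cons z c')
    then have "covered_by P le a z" "c \<in> maximal_chains P le z b"
      using Cons.prems by (simp_all add: maximal_chains_Cons)
    then have "le a z" "z \<in> P" "le z b" "b \<in> P"
      using Cons.IH[of z] by (auto simp: covered_by_def)
    then show ?thesis using le_trans[of a z b] Cons.prems by blast
  qed
qed

end

text \<open>In \<open>descent\<close> the new cover is required to lie below \<open>w\<close>, so it
  stays in every interval from \<open>a\<close> that contains \<open>w\<close>. The class
  \<open>wellorder\<close> provides a least label without any finiteness of the set of
  covers.\<close>

locale labeled_ranked_poset = ranked_poset P le rk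
  for P :: "'a set" and le :: "'a \<Rightarrow> 'a \<Rightarrow> bool" and rk :: "'a \<Rightarrow> 'a \<Rightarrow> nat" +
  fixes f :: "'a \<Rightarrow> 'a \<Rightarrow> 'l::wellorder"
  assumes label_inj:
      "\<lbrakk>covered_by P le a z; covered_by P le a z'; f a z = f a z'\<rbrakk> \<Longrightarrow> z = z'"
    and descent: "\<lbrakk>covered_by P le a z; covered_by P le z w; f z w < f a z\<rbrakk> \<Longrightarrow>
      \<exists>z'. covered_by P le a z' \<and> le z' w \<and> f a z' < f a z"
    and sorted_least: "\<lbrakk>a # z # c \<in> maximal_chains P le a b; sorted (labeling f (a # z # c));
      covered_by P le a z'; le z' b\<rbrakk> \<Longrightarrow> f a z \<le> f a z'"
begin

lemma maximal_chains_cases: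
  assumes "c \<in> maximal_chains P le a b" "a \<in> P" "a \<noteq> b"
  obtains z c' where "c = a # z # c'" "covered_by P le a z" "z \<in> P" "le z b"
    "z # c' \<in> maximal_chains P le z b"
proof -
  obtain z c' where c: "c = a # z # c'"
    using assms by (cases c rule: list.exhaust; cases "tl c") (auto simp: maximal_chains_def)
  then have "covered_by P le a z" "z # c' \<in> maximal_chains P le z b"
    using assms(1) by (simp_all add: maximal_chains_Cons)
  then show ?thesis
    using that c maximal_chains_le[of "z # c'" z b] by (auto simp: covered_by_def)
qed

lemma maximal_chains_self:
  assumes "a \<in> P" "c \<in> maximal_chains P le a a"
  shows "c = [a]"
proof (cases c)
  case Nil
  then show ?thesis using assms by (simp add: maximal_chains_def)
next
  case (Cons u c')
  show ?thesis
  proof (cases c')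
    case Nil
    then show ?thesis using assms Cons by (simp add: maximal_chains_def)
  next
    case (Cons z c'')
    then have "c = a # z # c''" using assms \<open>c = u # c'\<close> by (simp add: maximal_chains_def)
    then have cv: "covered_by P le a z" and m: "z # c'' \<in> maximal_chains P le z a"
      using assms maximal_chains_Cons by blast+
    then show ?thesis
      using maximal_chains_le[OF m] le_antisym[of a z] by (auto simp: covered_by_def)
  qed
qed

text \<open>The cover \<open>z\<close> with the least label is prepended to the inductive chain from
  \<open>z\<close>. A descent at the junction would contradict the choice of \<open>z\<close>. By
  \<open>sorted_least\<close> and \<open>label_inj\<close> every sorted chain also starts with
  \<open>z\<close>, and a chain starting elsewhere has a strictly larger first label.\<close>

lemma increasing_chain:
  assumes "a \<in> P" "b \<in> P" "le a b"
  shows "\<exists>c \<in> maximal_chains P le a b. sorted (labeling f c) \<and>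
    (\<forall>d \<in> maximal_chains P le a b. sorted (labeling f d) \<longrightarrow> d = c) \<and>
    (\<forall>d \<in> maximal_chains P le a b. labeling f c \<le> labeling f d)"
  using assms
proof (induction "rk a b" arbitrary: a rule: less_induct)
  case less
  show ?case
  proof (cases "a = b")
    case True
    have uniq: "d = [a]" if "d \<in> maximal_chains P le a b" for d
      using maximal_chains_self[of a d] less.prems(1) that True by blast
    have "[a] \<in> maximal_chains P le a b" "sorted (labeling f [a])"
      using True by (simp_all add: maximal_chains_def labeling_def)
    with uniq show ?thesis by (metis order_refl)
  next
    case False
    let ?A = "{z. covered_by P le a z \<and> le z b}"
    have "\<exists>t. t \<in> f a ` ?A" using covered_by_below[of a b] less.prems False by blast
    then have "(LEAST t. t \<in> f a ` ?A) \<in> f a ` ?A" by (rule LeastI_ex)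
    then obtain z where z: "z \<in> ?A" and fz: "f a z = (LEAST t. t \<in> f a ` ?A)" by auto
    have zmin: "f a z \<le> f a z'" if "z' \<in> ?A" for z'
      unfolding fz by (rule Least_le) (use that in blast)
    have zP: "z \<in> P" and az: "le a z" "a \<noteq> z" "le z b" and cz: "covered_by P le a z"
      using z by (auto simp: covered_by_def)
    have "rk z b < rk a b"
      using rk_add[of a z b] rk_eq_0[of a z] az zP less.prems by auto
    from less.hyps[OF this zP less.prems(2) az(3)] obtain c where
      c: "c \<in> maximal_chains P le z b" "sorted (labeling f c)"
      and cuniq: "\<And>d. d \<in> maximal_chains P le z b \<Longrightarrow> sorted (labeling f d) \<Longrightarrow> d = c"
      and cleast: "\<And>d. d \<in> maximal_chains P le z b \<Longrightarrow> labeling f c \<le> labeling f d"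
      by blast
    obtain c0 where c0: "c = z # c0"
      using c(1) by (cases c) (auto simp: maximal_chains_def)
    have ac: "a # z # c0 \<in> maximal_chains P le a b"
      using c(1) c0 cz maximal_chains_Cons by blast
    have "f a z \<le> hd (labeling f c)" if c0_ne: "c0 \<noteq> []"
    proof (rule ccontr)
      assume lt: "\<not> ?thesis"
      obtain w c1 where c1: "c0 = w # c1" using c0_ne by (auto simp: neq_Nil_conv)
      have "covered_by P le z w" "w # c1 \<in> maximal_chains P le w b"
        using c(1) c0 c1 maximal_chains_Cons by blast+
      then have w: "covered_by P le z w" "w \<in> P" "le w b"
        using maximal_chains_le by (auto simp: covered_by_def)
      have "f z w < f a z" using lt c0 c1 by (simp add: labeling_Cons)
      with descent[OF cz w(1)] obtain z' where z': "covered_by P le a z'" "le z' w" "f a z' < f a z"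
        by blast
      then have "z' \<in> ?A"
        using le_trans[of z' w b] w less.prems by (auto simp: covered_by_def)
      then show False using zmin z'(3) by fastforce
    qed
    then have sorted: "sorted (labeling f (a # z # c0))"
      using c(2) c0 by (cases c0) (auto simp: labeling_Cons labeling_def[of f "[_]"])
    have uniq: "d = a # z # c0"
      if d: "d \<in> maximal_chains P le a b" "sorted (labeling f d)" for d
    proof -
      obtain z' d' where d': "d = a # z' # d'" "covered_by P le a z'" "le z' b"
        "z' # d' \<in> maximal_chains P le z' b"
        using maximal_chains_cases[OF d(1)] less.prems False by metis
      have "f a z' \<le> f a z" using sorted_least[of a z' d' b z] d d' cz az by simp
      moreover have "f a z \<le> f a z'" using zmin d' by blast
      ultimately have "z' = z" using label_inj[OF d'(2) cz] by simp
      then show ?thesis using cuniq[of "z' # d'"] d d' c0 by (simp add: labeling_Cons)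
    qed
    have least: "labeling f (a # z # c0) \<le> labeling f d" if d: "d \<in> maximal_chains P le a b" for d
    proof -
      obtain z' d' where d': "d = a # z' # d'" "covered_by P le a z'" "le z' b"
        "z' # d' \<in> maximal_chains P le z' b"
        using maximal_chains_cases[OF d(1)] less.prems False by metis
      have "f a z \<le> f a z'" using zmin d' by blast
      then consider "f a z < f a z'" | "z' = z" "f a z = f a z'"
        using label_inj[OF cz d'(2)] by fastforce
      then show ?thesis
        using cleast[of "z # d'"] d' c0 by cases (simp_all add: labeling_Cons)
    qed
    show ?thesis using ac sorted uniq least by blast
  qed
qed

text \<open>Intervals are convex, so nothing outside can separate two elements of the interval.
  Hence the conditions on the whole poset serve for each subinterval.\<close>

lemma maximal_chains_closed_interval:
  assumes c: "c \<in> closed_interval P le a b" and d: "d \<in> closed_interval P le a b"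
    and P: "a \<in> P" "b \<in> P"
  shows "maximal_chains (closed_interval P le a b) le c d = maximal_chains P le c d"
proof -
  let ?I = "closed_interval P le a b"
  have cov: "covered_by ?I le u v \<longleftrightarrow> covered_by P le u v" if "u \<in> ?I" "v \<in> ?I" for u v
    using that le_trans[of a u] le_trans[of _ v b] P
    by (auto simp: covered_by_def closed_interval_def)
  have "xs \<in> maximal_chains ?I le c d" if "xs \<in> maximal_chains P le c d" for xs
    using that c
  proof (induction xs arbitrary: c rule: induct_list012)
    case (3 u z xs)
    then have u: "u = c" by (simp add: maximal_chains_def)
    then have cz: "covered_by P le c z" and m: "z # xs \<in> maximal_chains P le z d"
      using 3 maximal_chains_Cons by blast+
    then have "z \<in> ?I"
      using maximal_chains_le[OF m] "3.prems"(2) d le_trans[of a c z] le_trans[of z d b] P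
      by (auto simp: covered_by_def closed_interval_def)
    then show ?case
      using "3.IH"(2)[OF m] cov[of c z] cz "3.prems"(2) u by (simp add: maximal_chains_def)
  qed (auto simp: maximal_chains_def)
  moreover have "xs \<in> maximal_chains P le c d" if "xs \<in> maximal_chains ?I le c d" for xs
  proof -
    have "covered_by P le u v" if "covered_by ?I le u v" for u v
      using that cov[of u v] by (auto simp: covered_by_def)
    then show ?thesis
      using that by (auto simp: maximal_chains_def intro: successively_mono)
  qed
  ultimately show ?thesis by blast
qed

lemma EL_shelling_closed_interval:
  assumes P: "a \<in> P" "b \<in> P"
  shows "EL_shelling (closed_interval P le a b) le f"
proof -
  let ?I = "closed_interval P le a b"
  have "ranked_poset ?I le rk"
  proof
    fix u v assume uv: "u \<in> ?I" "v \<in> ?I" "le u v" "2 \<le> rk u v"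
    then obtain z where "z \<in> P" "le u z" "le z v" "z \<noteq> u" "z \<noteq> v"
      using rk_between[of u v] by (auto simp: closed_interval_def)
    then show "\<exists>z\<in>?I. le u z \<and> le z v \<and> z \<noteq> u \<and> z \<noteq> v"
      using uv le_trans[of a u z] le_trans[of z v b] P
      by (auto simp: closed_interval_def)
  qed (auto simp: closed_interval_def rk_eq_0 intro: le_refl le_antisym le_trans rk_add)
  then have "graded_poset ?I le"
    by (rule ranked_poset.graded)
  moreover have "\<exists>c \<in> maximal_chains ?I le u v. sorted (labeling f c) \<and>
      (\<forall>d \<in> maximal_chains ?I le u v. sorted (labeling f d) \<longrightarrow> d = c) \<and>
      (\<forall>d \<in> maximal_chains ?I le u v. labeling f c \<le> labeling f d)"
    if "u \<in> ?I" "v \<in> ?I" "le u v" for u v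
    using increasing_chain[of u v] maximal_chains_closed_interval[of u a b v] that P
    by (auto simp: closed_interval_def)
  ultimately show ?thesis unfolding EL_shelling_def by blast
qed

end

section \<open>Cyclic order, vacant rectangles, and recutting the union of two of them\<close>

section \<open>Rectangles and exchange of corners\<close>

definition cyc :: "nat \<Rightarrow> nat \<Rightarrow> nat \<Rightarrow> bool" where
  "cyc a b c \<longleftrightarrow> a < b \<and> b < c \<or> b < c \<and> c < a \<or> c < a \<and> a < b"

text \<open>Half-open, so that adjacent arcs tile, and empty for \<open>a = b\<close>. A wrapping
  arc contains all large numbers, hence the later intersections with \<open>{..<n}\<close>.\<close>

definition arc :: "nat \<Rightarrow> nat \<Rightarrow> nat set" where
  "arc a b = {i. i = a \<and> a \<noteq> b \<or> cyc a i b}"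

text \<open>\<open>rectangle s a b\<close> is the half-open rectangle with upper left corner \<open>(a, s a)\<close> and
  lower right corner \<open>(b, s b)\<close>.\<close>

definition rectangle :: "(nat \<Rightarrow> nat) \<Rightarrow> nat \<Rightarrow> nat \<Rightarrow> (nat \<times> nat) set" where
  "rectangle s a b = arc a b \<times> arc (s b) (s a)"

text \<open>Testing the lower generator suffices for an empty rectangle: the upper one differs from
  it only at two further corners of the same rectangle.\<close>

definition vacant :: "nat set \<Rightarrow> (nat \<Rightarrow> nat) \<Rightarrow> nat \<Rightarrow> nat \<Rightarrow> bool" where
  "vacant A s a b \<longleftrightarrow> a \<in> A \<and> b \<in> A \<and> a \<noteq> b \<and> (\<forall>u\<in>A. cyc a u b \<longrightarrow> \<not> cyc (s b) (s u) (s a))"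

definition swap :: "nat \<Rightarrow> nat \<Rightarrow> (nat \<Rightarrow> nat) \<Rightarrow> nat \<Rightarrow> nat" where
  "swap a b s = s(a := s b, b := s a)"

lemma cyc_cases:
  assumes "a \<noteq> b" "b \<noteq> c" "a \<noteq> c"
  obtains "cyc a b c" | "cyc a c b"
  using assms linorder_less_linear[of a b] linorder_less_linear[of b c] linorder_less_linear[of a c]
  unfolding cyc_def by blast

lemma cyc_trans: "cyc a b c \<Longrightarrow> cyc a c d \<Longrightarrow> cyc a b d"
  unfolding cyc_def by auto

lemma cyc_trans': "cyc b u c \<Longrightarrow> cyc a b c \<Longrightarrow> cyc a u c"
  unfolding cyc_def by auto

lemma cyc_split:
  assumes "cyc a u c" "cyc a b c" "u \<noteq> b"
  obtains "cyc a u b" | "cyc b u c"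
  using assms unfolding cyc_def by linarith

lemma not_cyc: "\<not> cyc a b c \<Longrightarrow> a \<noteq> b \<Longrightarrow> b \<noteq> c \<Longrightarrow> a \<noteq> c \<Longrightarrow> cyc b a c"
  using linorder_less_linear[of a b] linorder_less_linear[of b c] linorder_less_linear[of a c]
  unfolding cyc_def by blast

lemma cyc_outside:
  assumes "cyc a b c" "\<not> cyc a d c" "d \<noteq> a" "d \<noteq> c"
  shows "cyc d a b" "cyc b c d"
  using assms unfolding cyc_def by auto

lemma arc_iff: "a \<noteq> b \<Longrightarrow> i \<in> arc a b \<longleftrightarrow> (if a < b then a \<le> i \<and> i < b else a \<le> i \<or> i < b)"
  unfolding arc_def cyc_def by auto

lemma arc_split: "cyc a b c \<Longrightarrow> arc a c = arc a b \<union> arc b c"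
  unfolding arc_def cyc_def by auto

text \<open>Only the points in columns \<open>a\<close> and \<open>a'\<close> move. If one of them
  lay inside the second rectangle before the first step, then either the other column also passes
  through it and carries the same row afterwards, or a corner of the second rectangle lies inside
  the first one. Vacancy forbids both.\<close>

lemma exchange_disjoint:
  assumes "inj_on s A" "vacant A s a a'" "vacant A (swap a a' s) b b'"
    and "{a, a'} \<inter> {b, b'} = {}"
  shows "vacant A s b b' \<and> rectangle (swap a a' s) b b' = rectangle s b b'"
proof -
  have A: "a \<in> A" "a' \<in> A" "b \<in> A" "b' \<in> A" "a \<noteq> a'" "b \<noteq> b'"
    using assms by (auto simp: vacant_def)
  have ne: "a \<noteq> b" "a \<noteq> b'" "a' \<noteq> b" "a' \<noteq> b'" using assms(4) by auto
  have sne: "s a \<noteq> s b" "s a \<noteq> s b'" "s a' \<noteq> s b" "s a' \<noteq> s b'" "s a \<noteq> s a'" "s b \<noteq> s b'"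
    using assms(1) A ne by (simp_all add: inj_on_eq_iff)
  have E: "cyc a u a' \<Longrightarrow> \<not> cyc (s a') (s u) (s a)" if "u \<in> A" for u
    using assms(2) that by (auto simp: vacant_def)
  have F: "cyc b u b' \<Longrightarrow> \<not> cyc (s b') (swap a a' s u) (s b)" if "u \<in> A" for u
    using assms(3) that A ne by (auto simp: vacant_def swap_def)
  have Fa: "cyc b a b' \<Longrightarrow> \<not> cyc (s b') (s a') (s b)"
    and Fa': "cyc b a' b' \<Longrightarrow> \<not> cyc (s b') (s a) (s b)"
    using F[of a] F[of a'] A by (simp_all add: swap_def)
  note Eb = E[OF A(3)] and Eb' = E[OF A(4)]
  have 1: "\<not> cyc (s b') (s a) (s b)" if "cyc b a b'"
    using that Fa Fa' Eb' ne sne cyc_outside(2)[of b a b' a'] cyc_outside(1)[of "s b'" "s a" "s b" "s a'"]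
    by auto
  have 2: "\<not> cyc (s b') (s a') (s b)" if "cyc b a' b'"
    using that Fa Fa' Eb ne sne cyc_outside(1)[of b a' b' a] cyc_outside(2)[of "s b'" "s a'" "s b" "s a"]
    by auto
  have "\<not> cyc (s b') (s u) (s b)" if "u \<in> A" "cyc b u b'" for u
    using F[OF that(1)] 1 2 that(2) by (cases "u = a"; cases "u = a'") (auto simp: swap_def)
  then show ?thesis
    using A ne by (auto simp: vacant_def rectangle_def swap_def)
qed


text \<open>The second rectangle hangs below the first with the same left side. If it is narrower,
  the two form a vacant rectangle over its columns; if it is wider, its part to the right of column
  \<open>a'\<close> can be cut off first.\<close>

lemma exchange_left:
  assumes inj: "inj_on s A" and v: "vacant A s a a'" "vacant A (swap a a' s) a b'" and ne: "a' \<noteq> b'"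
  defines "t \<equiv> swap a a' s"
  shows "vacant A s a b' \<and> rectangle s a b' \<subseteq> rectangle s a a' \<union> rectangle t a b' \<or>
    cyc a a' b' \<and> vacant A s a' b' \<and> rectangle s a' b' \<subseteq> rectangle s a a' \<union> rectangle t a b'"
proof -
  have A: "a \<in> A" "a' \<in> A" "b' \<in> A" "a \<noteq> a'" "a \<noteq> b'"
    using v by (auto simp: vacant_def)
  have sne: "s a \<noteq> s b'" "s a' \<noteq> s b'" "s a \<noteq> s a'"
    using inj A ne by (simp_all add: inj_on_eq_iff)
  have t: "t a = s a'" "t a' = s a" "t b' = s b'" "\<And>u. u \<noteq> a \<Longrightarrow> u \<noteq> a' \<Longrightarrow> t u = s u"
    using A ne by (auto simp: t_def swap_def)
  have E: "cyc a u a' \<Longrightarrow> \<not> cyc (s a') (s u) (s a)" if "u \<in> A" for u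
    using v(1) that by (auto simp: vacant_def)
  have F: "cyc a u b' \<Longrightarrow> \<not> cyc (s b') (t u) (s a')" if "u \<in> A" for u
    using v(2) that t by (auto simp: vacant_def t_def[symmetric])
  have su: "s u \<noteq> s a" "s u \<noteq> s a'" "s u \<noteq> s b'" if "u \<in> A" "u \<noteq> a" "u \<noteq> a'" "u \<noteq> b'" for u
    using inj A that by (simp_all add: inj_on_eq_iff)
  note Eb' = E[OF A(3)]
  consider "cyc a b' a'" | "cyc a a' b'"
    using cyc_cases[of a b' a'] A ne by metis
  then show ?thesis
  proof cases
    case 1
    then have r: "\<not> cyc (s a') (s b') (s a)" using Eb' by blast
    have "\<not> cyc (s b') (s u) (s a)" if u: "u \<in> A" "cyc a u b'" for u
    proof -
      have "u \<noteq> a" "u \<noteq> a'" "u \<noteq> b'" using u 1 by (auto simp: cyc_def)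
      then show ?thesis
        using cyc_split[of "s b'" "s u" "s a" "s a'"] not_cyc[OF r] cyc_trans[OF u(2) 1] E[OF u(1)]
          F[OF u(1)] su[OF u(1)] t(4)[of u] sne u(2) by auto
    qed
    moreover have "rectangle s a b' \<subseteq> rectangle s a a' \<union> rectangle t a b'"
      using arc_split[OF 1] arc_split[OF not_cyc[OF r]] sne by (auto simp: rectangle_def t)
    ultimately show ?thesis using A by (auto simp: vacant_def)
  next
    case 2
    have "\<not> cyc (s b') (s u) (s a')" if u: "u \<in> A" "cyc a' u b'" for u
    proof -
      have "u \<noteq> a" "u \<noteq> a'" "u \<noteq> b'" using u 2 by (auto simp: cyc_def)
      then show ?thesis
        using cyc_trans'[OF u(2) 2] F[OF u(1)] t(4)[of u] by simp
    qed
    moreover have "rectangle s a' b' \<subseteq> rectangle s a a' \<union> rectangle t a b'"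
      using arc_split[OF 2] by (auto simp: rectangle_def t)
    ultimately show ?thesis using A ne 2 by (auto simp: vacant_def)
  qed
qed

text \<open>The second rectangle starts at the new upper right corner of the first and extends to
  the right. If it reaches lower than the first, its part below row \<open>s a'\<close> comes first;
  otherwise its rows are taken across both rectangles.\<close>

lemma exchange_right_corner:
  assumes inj: "inj_on s A" and v: "vacant A s a a'" "vacant A (swap a a' s) a' b'" and ne: "a \<noteq> b'"
  defines "t \<equiv> swap a a' s"
  shows "vacant A s a' b' \<and> rectangle s a' b' \<subseteq> rectangle s a a' \<union> rectangle t a' b' \<or>
    cyc a a' b' \<and> vacant A s a b' \<and> rectangle s a b' \<subseteq> rectangle s a a' \<union> rectangle t a' b'"
proof -
  have A: "a \<in> A" "a' \<in> A" "b' \<in> A" "a \<noteq> a'" "a' \<noteq> b'"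
    using v by (auto simp: vacant_def)
  have sne: "s a \<noteq> s b'" "s a' \<noteq> s b'" "s a \<noteq> s a'"
    using inj A ne by (simp_all add: inj_on_eq_iff)
  have t: "t a = s a'" "t a' = s a" "t b' = s b'" "\<And>u. u \<noteq> a \<Longrightarrow> u \<noteq> a' \<Longrightarrow> t u = s u"
    using A ne by (auto simp: t_def swap_def)
  have E: "cyc a u a' \<Longrightarrow> \<not> cyc (s a') (s u) (s a)" if "u \<in> A" for u
    using v(1) that by (auto simp: vacant_def)
  have F: "cyc a' u b' \<Longrightarrow> \<not> cyc (s b') (t u) (s a)" if "u \<in> A" for u
    using v(2) that t by (auto simp: vacant_def t_def[symmetric])
  have su: "s u \<noteq> s a" "s u \<noteq> s a'" "s u \<noteq> s b'" if "u \<in> A" "u \<noteq> a" "u \<noteq> a'" "u \<noteq> b'" for u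
    using inj A that by (simp_all add: inj_on_eq_iff)
  note Eb' = E[OF A(3)]
  consider "cyc (s b') (s a') (s a)" | "cyc (s a') (s b') (s a)"
    using cyc_cases[of "s b'" "s a'" "s a"] sne by (auto simp: cyc_def)
  then show ?thesis
  proof cases
    case 1
    have "\<not> cyc (s b') (s u) (s a')" if u: "u \<in> A" "cyc a' u b'" for u
    proof (cases "u = a")
      case True
      then show ?thesis using 1 by (auto simp: cyc_def)
    next
      case False
      have "u \<noteq> a'" "u \<noteq> b'" using u by (auto simp: cyc_def)
      then show ?thesis
        using False u F[OF u(1)] t(4)[of u] su[OF u(1)] cyc_trans[OF _ 1] by auto
    qed
    moreover have "rectangle s a' b' \<subseteq> rectangle s a a' \<union> rectangle t a' b'"
      using arc_split[OF 1] by (auto simp: rectangle_def t)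
    ultimately show ?thesis using A by (auto simp: vacant_def)
  next
    case 2
    then have r: "cyc a a' b'" using Eb' cyc_cases[of a a' b'] A ne by metis
    have "\<not> cyc (s b') (s u) (s a)" if u: "u \<in> A" "cyc a u b'" for u
    proof (cases "u = a'")
      case True
      then show ?thesis using 2 by (auto simp: cyc_def)
    next
      case False
      have "u \<noteq> a" "u \<noteq> b'" using u by (auto simp: cyc_def)
      then show ?thesis
        using False u cyc_split[OF u(2) r] E[OF u(1)] F[OF u(1)] t(4)[of u]
          cyc_trans'[OF _ 2] by auto
    qed
    moreover have "rectangle s a b' \<subseteq> rectangle s a a' \<union> rectangle t a' b'"
      using arc_split[OF 2] arc_split[OF r] by (auto simp: rectangle_def t)
    ultimately show ?thesis using A ne r by (auto simp: vacant_def)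
  qed
qed


text \<open>The second rectangle ends at the new lower left corner of the first and extends to the
  left. If it reaches higher, its part above row \<open>s a\<close> comes first; otherwise its rows
  are taken across both rectangles.\<close>

lemma exchange_left_corner:
  assumes inj: "inj_on s A" and v: "vacant A s a a'" "vacant A (swap a a' s) b a" and ne: "a' \<noteq> b"
  defines "t \<equiv> swap a a' s"
  shows "vacant A s b a \<and> rectangle s b a \<subseteq> rectangle s a a' \<union> rectangle t b a \<or>
    cyc b a a' \<and> vacant A s b a' \<and> rectangle s b a' \<subseteq> rectangle s a a' \<union> rectangle t b a"
proof -
  have A: "a \<in> A" "a' \<in> A" "b \<in> A" "a \<noteq> a'" "a \<noteq> b"
    using v by (auto simp: vacant_def)
  have sne: "s a \<noteq> s b" "s a' \<noteq> s b" "s a \<noteq> s a'"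
    using inj A ne by (simp_all add: inj_on_eq_iff)
  have t: "t a = s a'" "t a' = s a" "t b = s b" "\<And>u. u \<noteq> a \<Longrightarrow> u \<noteq> a' \<Longrightarrow> t u = s u"
    using A ne by (auto simp: t_def swap_def)
  have E: "cyc a u a' \<Longrightarrow> \<not> cyc (s a') (s u) (s a)" if "u \<in> A" for u
    using v(1) that by (auto simp: vacant_def)
  have F: "cyc b u a \<Longrightarrow> \<not> cyc (s a') (t u) (s b)" if "u \<in> A" for u
    using v(2) that t by (auto simp: vacant_def t_def[symmetric])
  have su: "s u \<noteq> s a" "s u \<noteq> s a'" "s u \<noteq> s b" if "u \<in> A" "u \<noteq> a" "u \<noteq> a'" "u \<noteq> b" for u
    using inj A that by (simp_all add: inj_on_eq_iff)
  note Eb = E[OF A(3)]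
  consider "cyc (s a') (s a) (s b)" | "cyc (s a') (s b) (s a)"
    using cyc_cases[of "s a'" "s a" "s b"] sne by metis
  then show ?thesis
  proof cases
    case 1
    have "\<not> cyc (s a) (s u) (s b)" if u: "u \<in> A" "cyc b u a" for u
    proof (cases "u = a'")
      case True
      then show ?thesis using 1 by (auto simp: cyc_def)
    next
      case False
      have "u \<noteq> a" "u \<noteq> b" using u by (auto simp: cyc_def)
      then show ?thesis
        using False u F[OF u(1)] t(4)[of u] su[OF u(1)] cyc_trans'[OF _ 1] by auto
    qed
    moreover have "rectangle s b a \<subseteq> rectangle s a a' \<union> rectangle t b a"
      using arc_split[OF 1] by (auto simp: rectangle_def t)
    ultimately show ?thesis using A by (auto simp: vacant_def)
  next
    case 2
    then have r: "cyc b a a'" using not_cyc[of a b a'] Eb A ne by metis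
    have "\<not> cyc (s a') (s u) (s b)" if u: "u \<in> A" "cyc b u a'" for u
    proof (cases "u = a")
      case True
      then show ?thesis using 2 by (auto simp: cyc_def)
    next
      case False
      have "u \<noteq> a'" "u \<noteq> b" using u by (auto simp: cyc_def)
      then show ?thesis
        using False u cyc_split[OF u(2) r] E[OF u(1)] F[OF u(1)] t(4)[of u]
          cyc_trans[OF _ 2] by auto
    qed
    moreover have "rectangle s b a' \<subseteq> rectangle s a a' \<union> rectangle t b a"
      using arc_split[OF 2] arc_split[OF r] by (auto simp: rectangle_def t)
    ultimately show ?thesis using A ne r by (auto simp: vacant_def)
  qed
qed

text \<open>The second rectangle stands on the first with the same right side. If it is narrower,
  its columns are taken through both; if it is wider, its part to the left of column
  \<open>a\<close> comes first.\<close>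

lemma exchange_right:
  assumes inj: "inj_on s A" and v: "vacant A s a a'" "vacant A (swap a a' s) b a'" and ne: "a \<noteq> b"
  defines "t \<equiv> swap a a' s"
  shows "vacant A s b a' \<and> rectangle s b a' \<subseteq> rectangle s a a' \<union> rectangle t b a' \<or>
    cyc b a a' \<and> vacant A s b a \<and> rectangle s b a \<subseteq> rectangle s a a' \<union> rectangle t b a'"
proof -
  have A: "a \<in> A" "a' \<in> A" "b \<in> A" "a \<noteq> a'" "a' \<noteq> b"
    using v by (auto simp: vacant_def)
  have sne: "s a \<noteq> s b" "s a' \<noteq> s b" "s a \<noteq> s a'"
    using inj A ne by (simp_all add: inj_on_eq_iff)
  have t: "t a = s a'" "t a' = s a" "t b = s b" "\<And>u. u \<noteq> a \<Longrightarrow> u \<noteq> a' \<Longrightarrow> t u = s u"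
    using A ne by (auto simp: t_def swap_def)
  have E: "cyc a u a' \<Longrightarrow> \<not> cyc (s a') (s u) (s a)" if "u \<in> A" for u
    using v(1) that by (auto simp: vacant_def)
  have F: "cyc b u a' \<Longrightarrow> \<not> cyc (s a) (t u) (s b)" if "u \<in> A" for u
    using v(2) that t by (auto simp: vacant_def t_def[symmetric])
  have su: "s u \<noteq> s a" "s u \<noteq> s a'" "s u \<noteq> s b" if "u \<in> A" "u \<noteq> a" "u \<noteq> a'" "u \<noteq> b" for u
    using inj A that by (simp_all add: inj_on_eq_iff)
  note Eb = E[OF A(3)]
  consider "cyc a b a'" | "cyc b a a'"
    using cyc_cases[of a b a'] A ne by (auto simp: cyc_def)
  then show ?thesis
  proof cases
    case 1
    then have r: "cyc (s a') (s a) (s b)" using Eb sne by (auto simp: cyc_def)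
    have "\<not> cyc (s a') (s u) (s b)" if u: "u \<in> A" "cyc b u a'" for u
    proof -
      have "u \<noteq> a" "u \<noteq> a'" "u \<noteq> b" using u 1 by (auto simp: cyc_def)
      then show ?thesis
        using cyc_split[of "s a'" "s u" "s b" "s a"] cyc_trans'[OF u(2) 1] E[OF u(1)]
          F[OF u(1)] su[OF u(1)] t(4)[of u] r u(2) by auto
    qed
    moreover have "rectangle s b a' \<subseteq> rectangle s a a' \<union> rectangle t b a'"
      using arc_split[OF 1] arc_split[OF r] by (auto simp: rectangle_def t)
    ultimately show ?thesis using A by (auto simp: vacant_def)
  next
    case 2
    have "\<not> cyc (s a) (s u) (s b)" if u: "u \<in> A" "cyc b u a" for u
    proof -
      have "u \<noteq> a" "u \<noteq> a'" "u \<noteq> b" using u 2 by (auto simp: cyc_def)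
      then show ?thesis
        using cyc_trans[OF u(2) 2] F[OF u(1)] t(4)[of u] by simp
    qed
    moreover have "rectangle s b a \<subseteq> rectangle s a a' \<union> rectangle t b a'"
      using arc_split[OF 2] by (auto simp: rectangle_def t)
    ultimately show ?thesis using A ne 2 by (auto simp: vacant_def)
  qed
qed

text \<open>If the column pairs coincide, the union is an annulus and has no second cut. The cyclic
  conditions in the conclusion record the relative position of the columns, from which the labels
  are compared later.\<close>

lemma exchange:
  assumes inj: "inj_on s A" and v: "vacant A s a a'" "vacant A (swap a a' s) b b'"
    and ne: "{a, a'} \<noteq> {b, b'}"
  obtains c c' where "vacant A s c c'"
    "rectangle s c c' \<subseteq> rectangle s a a' \<union> rectangle (swap a a' s) b b'"
    "c = b \<and> c' = b' \<or> b = a \<and> cyc a a' b' \<and> c = a' \<and> c' = b' \<or>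
     b = a' \<and> cyc a a' b' \<and> c = a \<and> c' = b' \<or> b' = a \<and> cyc b a a' \<and> c = b \<and> c' = a' \<or>
     b' = a' \<and> cyc b a a' \<and> c = b \<and> c' = a"
proof -
  consider "{a, a'} \<inter> {b, b'} = {}" | "b = a" "a' \<noteq> b'" | "b = a'" "a \<noteq> b'" | "b' = a" "a' \<noteq> b"
    | "b' = a'" "a \<noteq> b"
    using ne by blast
  then show ?thesis
  proof cases
    case 1
    then show ?thesis using exchange_disjoint[OF inj v] that[of b b'] by auto
  next
    case 2
    then show ?thesis
      using exchange_left[OF inj v(1), of b'] v(2) that[of a b'] that[of a' b'] by auto
  next
    case 3
    then show ?thesis
      using exchange_right_corner[OF inj v(1), of b'] v(2) that[of a' b'] that[of a b'] by auto
  next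
    case 4
    then show ?thesis
      using exchange_left_corner[OF inj v(1), of b] v(2) that[of b a] that[of b a'] by auto
  next
    case 5
    then show ?thesis
      using exchange_right[OF inj v(1), of b] v(2) that[of b a'] that[of b a] by auto
  qed
qed

section \<open>Generators as permutations and rectangles as 2-chains\<close>

section \<open>Generators and domains\<close>

definition prd :: "nat \<Rightarrow> nat \<Rightarrow> nat" where
  "prd n i = (i + n - 1) mod n"

lemma prd_if: "i < n \<Longrightarrow> prd n i = (if i = 0 then n - 1 else i - 1)"
  by (auto simp: prd_def mod_if)

lemma prd_less: "i < n \<Longrightarrow> prd n i < n"
  by (auto simp: prd_def)

lemma bij_betw_prd: "bij_betw (prd n) {..<n} {..<n}"
proof -
  have "inj_on (prd n) {..<n}"
    by (auto simp: inj_on_def prd_if split: if_splits)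
  moreover have "prd n ` {..<n} \<subseteq> {..<n}"
    using prd_less by auto
  ultimately show ?thesis
    by (metis bij_betw_def card_image card_subset_eq finite_lessThan)
qed

definition mixed_diff :: "nat \<Rightarrow> two_chain \<Rightarrow> nat \<times> nat \<Rightarrow> int" where
  "mixed_diff n D = (\<lambda>(i, j). D (prd n i, j) + D (i, prd n j) - D (i, j) - D (prd n i, prd n j))"

lemma arcs_boundary_alpha_boundary: "arcs_boundary n (alpha_boundary n D) = mixed_diff n D"
  by (auto simp: arcs_boundary_def alpha_boundary_def mixed_diff_def prd_def fun_eq_iff)

lemma domains_iff:
  "D \<in> domains n S T \<longleftrightarrow> D \<in> two_chains n \<and>
    (\<forall>i<n. \<forall>j<n. mixed_diff n D (i, j) = of_bool ((i, j) \<in> T) - of_bool ((i, j) \<in> S))"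
  by (auto simp: domains_def arcs_boundary_alpha_boundary torus_grid_def)

text \<open>The difference of two adjacent columns of \<open>D\<close> does not change from row to
  row, so \<open>D\<close> splits into a function of the column plus a function of the row.\<close>

lemma mixed_diff_0_split:
  assumes "\<And>i j. i < n \<Longrightarrow> j < n \<Longrightarrow> mixed_diff n D (i, j) = 0" and "i < n" "j < n"
  shows "D (i, j) = D (i, 0) + D (0, j) - D (0, 0)"
  using assms(2,3)
proof (induction i arbitrary: j)
  case 0
  then show ?case by simp
next
  case (Suc i)
  have step: "D (i, j) + D (Suc i, j - 1) = D (Suc i, j) + D (i, j - 1)" if "0 < j" "j < n" for j
    using assms(1)[of "Suc i" j] that Suc.prems by (simp add: mixed_diff_def prd_if)
  have "D (Suc i, j) - D (i, j) = D (Suc i, 0) - D (i, 0)"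
    using Suc.prems(2)
  proof (induction j)
    case (Suc j)
    then show ?case using step[of "Suc j"] by simp
  qed simp
  then show ?case using Suc.IH[of j] Suc.prems by simp
qed

definition row :: "(nat \<times> nat) set \<Rightarrow> nat \<Rightarrow> nat" where
  "row S i = (THE j. (i, j) \<in> S)"

definition graph :: "nat \<Rightarrow> (nat \<Rightarrow> nat) \<Rightarrow> (nat \<times> nat) set" where
  "graph n s = {(i, s i) | i. i < n}"

lemma mem_graph [simp]: "(i, j) \<in> graph n s \<longleftrightarrow> i < n \<and> j = s i"
  by (auto simp: graph_def)

lemma generator_row:
  assumes "S \<in> generators n"
  shows mem_generator: "(i, j) \<in> S \<longleftrightarrow> i < n \<and> j = row S i"
    and row_less: "i < n \<Longrightarrow> row S i < n"
    and inj_on_row: "inj_on (row S) {..<n}"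
proof -
  have sub: "S \<subseteq> {..<n} \<times> {..<n}"
    and col: "\<And>i. i < n \<Longrightarrow> \<exists>!p. p \<in> S \<and> fst p = i" and rw: "\<And>j. j < n \<Longrightarrow> \<exists>!p. p \<in> S \<and> snd p = j"
    using assms by (auto simp: generators_def torus_grid_def)
  have "\<exists>!j. (i, j) \<in> S" if "i < n" for i
    using col[OF that] by (auto simp: Ex1_def)
  then have row: "(i, j) \<in> S \<longleftrightarrow> j = row S i" if "i < n" for i j
    using that theI'[of "\<lambda>j. (i, j) \<in> S"] unfolding row_def by blast
  then show mem: "(i, j) \<in> S \<longleftrightarrow> i < n \<and> j = row S i" for i j
    using sub by auto
  then show less: "i < n \<Longrightarrow> row S i < n" for i
    using sub by blast
  show "inj_on (row S) {..<n}"
  proof (rule inj_onI)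
    fix i i' assume "i \<in> {..<n}" "i' \<in> {..<n}" "row S i = row S i'"
    then have "(i, row S i) \<in> S" "(i', row S i) \<in> S" "row S i < n" using mem less by auto
    then show "i = i'" using rw[of "row S i"] by (metis fst_conv snd_conv)
  qed
qed

lemma row_graph [simp]: "i < n \<Longrightarrow> row (graph n s) i = s i"
  by (simp add: row_def)

lemma graph_row: "S \<in> generators n \<Longrightarrow> graph n (row S) = S"
  using mem_generator by (auto simp: graph_def)

lemma graph_generators:
  assumes "inj_on s {..<n}" "s ` {..<n} \<subseteq> {..<n}"
  shows "graph n s \<in> generators n"
proof -
  have "s ` {..<n} = {..<n}"
    using assms by (metis card_image card_subset_eq finite_lessThan)
  then have ex: "\<exists>i<n. s i = j" if "j < n" for j using that by (metis imageE lessThan_iff)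
  have "\<exists>!p. p \<in> graph n s \<and> snd p = j" if "j < n" for j
  proof -
    obtain i where "i < n" "s i = j" using ex \<open>j < n\<close> by blast
    then show ?thesis
      using assms(1) by (intro ex1I[of _ "(i, j)"]) (auto simp: graph_def inj_on_def)
  qed
  moreover have "\<exists>!p. p \<in> graph n s \<and> fst p = i" if "i < n" for i
    using that by (auto simp: graph_def Ex1_def)
  moreover have "graph n s \<subseteq> torus_grid n"
    using assms(2) by (auto simp: graph_def torus_grid_def)
  ultimately show ?thesis by (auto simp: generators_def)
qed

lemma swap_simps [simp]:
  "swap a b s a = s b" "swap a b s b = s a" "u \<noteq> a \<Longrightarrow> u \<noteq> b \<Longrightarrow> swap a b s u = s u"
  by (auto simp: swap_def)

lemma inj_on_swap: "inj_on s A \<Longrightarrow> a \<in> A \<Longrightarrow> b \<in> A \<Longrightarrow> inj_on (swap a b s) A"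
  unfolding inj_on_def swap_def by (auto split: if_splits)

lemma graph_swap_generators:
  assumes "S \<in> generators n" "a < n" "b < n"
  shows "graph n (swap a b (row S)) \<in> generators n"
proof (rule graph_generators)
  show "inj_on (swap a b (row S)) {..<n}"
    using inj_on_swap inj_on_row assms by auto
  show "swap a b (row S) ` {..<n} \<subseteq> {..<n}"
    using row_less assms by (auto simp: swap_def)
qed

text \<open>Discrete derivative of the indicator of a half-open arc: it rises at the start and drops
  at the end, across the wraparound too.\<close>

lemma arc_prd:
  assumes "i < n" "a < n" "b < n" "a \<noteq> b"
  shows "of_bool (i \<in> arc a b) - of_bool (prd n i \<in> arc a b) = (of_bool (i = a) - of_bool (i = b) :: int)"
proof -
  have "i \<in> arc a b \<longleftrightarrow> (if i = a then True else if i = b then False else prd n i \<in> arc a b)"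
    using assms by (simp add: arc_iff prd_if) linarith
  moreover have "prd n a \<notin> arc a b" "prd n b \<in> arc a b"
    using assms by (simp_all add: arc_iff prd_if) linarith+
  ultimately show ?thesis using assms(4) by auto
qed

definition rect_chain :: "nat \<Rightarrow> (nat \<Rightarrow> nat) \<Rightarrow> nat \<Rightarrow> nat \<Rightarrow> two_chain" where
  "rect_chain n s a b p = of_bool (p \<in> rectangle s a b \<inter> torus_grid n)"

lemma rect_chain_eq:
  "rect_chain n s a b (i, j) =
    (if i < n \<and> j < n then of_bool (i \<in> arc a b) * of_bool (j \<in> arc (s b) (s a)) else 0)"
  by (auto simp: rect_chain_def rectangle_def torus_grid_def)

text \<open>The chain is a product of an indicator in the column and one in the row, so its mixed
  difference is, up to sign, the product of their derivatives.\<close>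

lemma mixed_diff_rect_chain:
  assumes "i < n" "j < n" "a < n" "b < n" "s a < n" "s b < n" "a \<noteq> b" "s a \<noteq> s b"
  shows "mixed_diff n (rect_chain n s a b) (i, j) =
    (of_bool (i = a) - of_bool (i = b)) * (of_bool (j = s a) - of_bool (j = s b))"
proof -
  let ?f = "\<lambda>i. of_bool (i \<in> arc a b) :: int" and ?g = "\<lambda>j. of_bool (j \<in> arc (s b) (s a)) :: int"
  have "mixed_diff n (rect_chain n s a b) (i, j) =
      - ((?f i - ?f (prd n i)) * (?g j - ?g (prd n j)))"
    using assms prd_less[of i n] prd_less[of j n]
    by (simp add: mixed_diff_def rect_chain_eq algebra_simps)
  then show ?thesis
    using arc_prd[of i n a b] arc_prd[of j n "s b" "s a"] assms by (simp add: algebra_simps)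
qed

lemma rect_chain_domains:
  assumes "S \<in> generators n" "a < n" "b < n" "a \<noteq> b"
  shows "rect_chain n (row S) a b \<in> domains n (graph n (swap a b (row S))) S"
  unfolding domains_iff
proof (intro conjI allI impI)
  have ne: "row S a \<noteq> row S b"
    using inj_on_row[OF assms(1)] assms by (auto simp: inj_on_def)
  show "rect_chain n (row S) a b \<in> two_chains n"
    by (auto simp: two_chains_def rect_chain_def)
  fix i j assume ij: "i < n" "j < n"
  then have "mixed_diff n (rect_chain n (row S) a b) (i, j) =
      (of_bool (i = a) - of_bool (i = b)) * (of_bool (j = row S a) - of_bool (j = row S b))"
    using assms row_less ne by (intro mixed_diff_rect_chain) auto
  then show "mixed_diff n (rect_chain n (row S) a b) (i, j) =
      of_bool ((i, j) \<in> S) - of_bool ((i, j) \<in> graph n (swap a b (row S)))"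
    using assms ij ne by (cases "i = a"; cases "i = b") (auto simp: mem_generator)
qed

section \<open>Markings, uniqueness of domains, and the partial order\<close>

section \<open>The grid poset\<close>

locale grid =
  fixes n :: nat and Xs Os :: "nat \<Rightarrow> nat \<times> nat"
  assumes grid: "grid_diagram n Xs Os"
begin

abbreviation "G \<equiv> grid_elements n"
abbreviation "doms \<equiv> element_domains n Xs Os"
abbreviation "le \<equiv> grid_le n Xs Os"

lemma n_pos: "0 < n"
  using grid by (simp add: grid_diagram_def)

lemma X_torus: "i < n \<Longrightarrow> Xs i \<in> torus_grid n" and O_torus: "i < n \<Longrightarrow> Os i \<in> torus_grid n"
  using grid[unfolded grid_diagram_def, THEN conjunct2, THEN conjunct1] by blast+

lemma grid_row:
  assumes "r < n"
  obtains i where "i < n" "{k. k < n \<and> snd (Xs k) = r} = {i}" "{k. k < n \<and> snd (Os k) = r} = {i}"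
  using grid[unfolded grid_diagram_def, THEN conjunct2, THEN conjunct2, THEN conjunct1, rule_format,
      OF assms]
  by (elim exE conjE) (rule that)

lemma grid_col:
  assumes "c < n"
  obtains i where "i < n" "{k. k < n \<and> fst (Os k) = c} = {i}"
    "{k. k < n \<and> fst (Xs k) = c} = {(i + 1) mod n}"
  using grid[unfolded grid_diagram_def, THEN conjunct2, THEN conjunct2, THEN conjunct2, rule_format,
      OF assms]
  by (elim exE conjE) (rule that)

lemma snd_X_O:
  assumes "i < n"
  shows "snd (Xs i) = snd (Os i)"
proof -
  have "snd (Xs i) < n" using X_torus[OF assms] by (auto simp: torus_grid_def)
  then obtain k where k: "k < n" "{k. k < n \<and> snd (Xs k) = snd (Xs i)} = {k}" "{k. k < n \<and> snd (Os k) = snd (Xs i)} = {k}"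
    by (rule grid_row)
  then have "i = k" using assms by blast
  moreover have "snd (Os k) = snd (Xs i)" using k(3) by blast
  ultimately show ?thesis by simp
qed

lemma fst_O_X:
  assumes "i < n"
  shows "fst (Os i) = fst (Xs (Suc i mod n))"
proof -
  have "fst (Os i) < n" using O_torus[OF assms] by (auto simp: torus_grid_def)
  then obtain k where k: "k < n" "{k. k < n \<and> fst (Os k) = fst (Os i)} = {k}"
    "{k. k < n \<and> fst (Xs k) = fst (Os i)} = {(k + 1) mod n}"
    by (rule grid_col)
  then have "i = k" using assms by blast
  moreover have "fst (Xs ((k + 1) mod n)) = fst (Os i)" using k(3) by blast
  ultimately show ?thesis by simp
qed

lemma ex_X_row:
  assumes "j < n"
  obtains i where "i < n" "(i, j) \<in> Xs ` {..<n}"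
proof -
  obtain k where k: "k < n" "{k. k < n \<and> snd (Xs k) = j} = {k}" "{k. k < n \<and> snd (Os k) = j} = {k}"
    by (rule grid_row[OF assms])
  have "k \<in> {k. k < n \<and> snd (Xs k) = j}" unfolding k(2) by simp
  then have "Xs k = (fst (Xs k), j)" by (simp add: prod_eq_iff)
  moreover have "fst (Xs k) < n" using X_torus[OF k(1)] by (auto simp: torus_grid_def)
  ultimately show ?thesis
    using that k(1) by (metis imageI lessThan_iff)
qed

lemma ex_X_col:
  assumes "i < n"
  obtains j where "j < n" "(i, j) \<in> Xs ` {..<n}"
proof -
  obtain k where k: "k < n" "{k. k < n \<and> fst (Os k) = i} = {k}"
    "{k. k < n \<and> fst (Xs k) = i} = {(k + 1) mod n}"
    by (rule grid_col[OF assms])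
  define m where "m = (k + 1) mod n"
  have "m \<in> {k. k < n \<and> fst (Xs k) = i}" unfolding k(3) m_def by simp
  then have m: "m < n" "Xs m = (i, snd (Xs m))" by (simp_all add: prod_eq_iff)
  moreover have "snd (Xs m) < n" using X_torus[OF m(1)] by (auto simp: torus_grid_def)
  ultimately show ?thesis
    using that by (metis imageI lessThan_iff)
qed

text \<open>Such a chain is a sum \<open>f i + g j\<close>; the zeros at the markings propagate along the knot
  to make \<open>f\<close> and \<open>-g\<close> equal to one constant.\<close>

lemma mixed_diff_0_unique:
  assumes D: "D \<in> two_chains n" and 0: "\<And>i j. i < n \<Longrightarrow> j < n \<Longrightarrow> mixed_diff n D (i, j) = 0"
    and X: "\<And>i. i < n \<Longrightarrow> D (Xs i) = 0" and O: "\<And>i. i < n \<Longrightarrow> D (Os i) = 0"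
  shows "D = (\<lambda>_. 0)"
proof -
  define f where "f i = D (i, 0)" for i
  define g where "g j = D (0, j) - D (0, 0)" for j
  have split: "D (i, j) = f i + g j" if "i < n" "j < n" for i j
    using mixed_diff_0_split[of n D i j] 0 that by (simp add: f_def g_def)
  have X': "f (fst (Xs i)) + g (snd (Xs i)) = 0" if "i < n" for i
    using split[of "fst (Xs i)" "snd (Xs i)"] X[OF that] X_torus[OF that]
    by (auto simp: torus_grid_def)
  have O': "f (fst (Os i)) + g (snd (Os i)) = 0" if "i < n" for i
    using split[of "fst (Os i)" "snd (Os i)"] O[OF that] O_torus[OF that]
    by (auto simp: torus_grid_def)
  have const: "f (fst (Xs i)) = f (fst (Xs 0))" if "i < n" for i
    using that
  proof (induction i)
    case (Suc i)
    then show ?case using X'[of i] O'[of i] snd_X_O[of i] fst_O_X[of i] by simp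
  qed simp
  have "D (i, j) = 0" if ij: "i < n" "j < n" for i j
  proof -
    obtain j' k where "k < n" "Xs k = (i, j')" using ex_X_col[OF ij(1)] by (metis imageE lessThan_iff)
    then have fi: "f i = f (fst (Xs 0))" using const[of k] by simp
    obtain i' k where "k < n" "Xs k = (i', j)" using ex_X_row[OF ij(2)] by (metis imageE lessThan_iff)
    then have "f (fst (Xs 0)) + g j = 0" using const[of k] X'[of k] by simp
    then show ?thesis using split ij fi by simp
  qed
  then show ?thesis
    using D unfolding two_chains_def torus_grid_def
    by (auto simp: fun_eq_iff)
qed

lemma dom_iff:
  "D \<in> doms x y \<longleftrightarrow> D \<in> two_chains n \<and>
    (\<forall>i<n. \<forall>j<n. mixed_diff n D (i, j) = of_bool ((i, j) \<in> fst y) - of_bool ((i, j) \<in> fst x)) \<and>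
    (\<forall>i<n. D (Os i) = int (snd y i) - int (snd x i) \<and> D (Xs i) = 0)"
  by (auto simp: element_domains_def domains_iff)

lemma mixed_diff_add: "mixed_diff n (\<lambda>p. D p + E p) q = mixed_diff n D q + mixed_diff n E q"
  and mixed_diff_diff: "mixed_diff n (\<lambda>p. D p - E p) q = mixed_diff n D q - mixed_diff n E q"
  by (cases q; simp add: mixed_diff_def)+

text \<open>The difference of two such domains has no mixed difference and vanishes at every X and
  O.\<close>

lemma dom_unique:
  assumes "D \<in> doms x y" "E \<in> doms x y"
  shows "D = E"
proof -
  have "(\<lambda>p. D p - E p) = (\<lambda>_. 0)"
    using assms by (intro mixed_diff_0_unique) (auto simp: dom_iff mixed_diff_diff two_chains_def)
  then show ?thesis by (auto simp: fun_eq_iff)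
qed

lemma dom_add: "D \<in> doms x y \<Longrightarrow> E \<in> doms y z \<Longrightarrow> (\<lambda>p. D p + E p) \<in> doms x z"
  by (auto simp: dom_iff mixed_diff_add two_chains_def)

lemma dom_diff: "D \<in> doms x z \<Longrightarrow> E \<in> doms y z \<Longrightarrow> (\<lambda>p. D p - E p) \<in> doms x y"
  by (auto simp: dom_iff mixed_diff_diff two_chains_def)

lemma dom_0: "(\<lambda>_. 0) \<in> doms x x"
  by (auto simp: dom_iff mixed_diff_def two_chains_def)

lemma G_iff: "x \<in> G \<longleftrightarrow> fst x \<in> generators n \<and> (\<forall>i\<ge>n. snd x i = 0)"
  by (cases x) (auto simp: grid_elements_def)

lemma dom_0_eq:
  assumes "(\<lambda>_. 0) \<in> doms x y" "x \<in> G" "y \<in> G"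
  shows "x = y"
proof -
  have gen: "fst x \<in> generators n" "fst y \<in> generators n" using assms by (auto simp: G_iff)
  have "(i, j) \<in> fst x \<longleftrightarrow> (i, j) \<in> fst y" if "i < n" "j < n" for i j
    using assms(1) that by (auto simp: dom_iff mixed_diff_def of_bool_def split: if_splits)
  moreover have "fst x \<subseteq> {..<n} \<times> {..<n}" "fst y \<subseteq> {..<n} \<times> {..<n}"
    using gen by (auto simp: generators_def torus_grid_def)
  ultimately have "fst x = fst y" by (intro set_eqI) (metis (no_types, lifting) SigmaD1 SigmaD2 lessThan_iff prod.collapse subsetD)
  moreover have "snd x i = snd y i" for i
    using assms by (cases "i < n") (auto simp: dom_iff G_iff)
  ultimately show ?thesis by (auto simp: prod_eq_iff fun_eq_iff)
qed

lemma nonneg: "D \<in> two_chains n \<Longrightarrow> positive_chain n D \<longleftrightarrow> (\<forall>p. 0 \<le> D p)"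
  by (auto simp: positive_chain_def two_chains_def)

lemma le_iff: "le y x \<longleftrightarrow> (\<exists>D \<in> doms x y. \<forall>p. 0 \<le> D p)"
  using nonneg by (auto simp: grid_le_def dom_iff)

lemma leI: "D \<in> doms x y \<Longrightarrow> (\<And>p. 0 \<le> D p) \<Longrightarrow> le y x"
  by (auto simp: le_iff)

lemma leE:
  assumes "le y x"
  obtains D where "D \<in> doms x y" "\<And>p. 0 \<le> D p"
  using assms by (auto simp: le_iff)

lemma grid_le_refl: "le x x"
  by (rule leI[OF dom_0]) simp

lemma grid_le_trans: "le x y \<Longrightarrow> le y z \<Longrightarrow> le x z"
  by (elim leE, rule leI, rule dom_add) (auto intro: add_nonneg_nonneg)

text \<open>The two positive domains add up to a domain from \<open>y\<close> to \<open>y\<close>,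
  which is 0 by uniqueness; so both vanish.\<close>

lemma grid_le_antisym:
  assumes "le x y" "le y x" "x \<in> G" "y \<in> G"
  shows "x = y"
proof -
  obtain D E where D: "D \<in> doms y x" "\<And>p. 0 \<le> D p" and E: "E \<in> doms x y" "\<And>p. 0 \<le> E p"
    using assms by (auto elim!: leE)
  have "D p + E p = 0" for p
    using fun_cong[OF dom_unique[OF dom_add[OF D(1) E(1)] dom_0], of p] .
  then have "D p = 0" for p
    using D(2)[of p] E(2)[of p] by (metis add_nonneg_eq_0_iff)
  then have "D = (\<lambda>_. 0)" by auto
  then show ?thesis using D(1) dom_0_eq[of y x] assms by simp
qed

end

section \<open>Unrolling the torus and finding a rectangle under a positive domain\<close>

section \<open>Rectangles in positive domains\<close>

lemma prd_nat_mod: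
  assumes "0 < n"
  shows "prd n (nat (i mod int n)) = nat ((i - 1) mod int n)"
proof -
  have "int (prd n (nat (i mod int n))) = (int (nat (i mod int n) + n - 1)) mod int n"
    by (simp add: prd_def zmod_int)
  also have "int (nat (i mod int n) + n - 1) = i mod int n - 1 + int n"
    using assms by (simp add: of_nat_diff)
  also have "(i mod int n - 1 + int n) mod int n = (i - 1) mod int n"
    by (simp add: mod_simps)
  finally show ?thesis using assms by simp
qed

lemma mod_diff_if:
  fixes a b m :: int
  assumes "0 \<le> a" "a < m" "0 \<le> b" "b < m"
  shows "(b - a) mod m = (if a \<le> b then b - a else b - a + m)"
  using assms mod_add_self2[of "b - a" m] mod_pos_pos_trivial[of "b - a + m" m] by auto

text \<open>Transfers from the unrolled plane back to cyclic arcs. The witness is the representative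
  of \<open>i\<close> in the window of length \<open>n\<close> that starts at \<open>a\<close>;
  since the interval is shorter than \<open>n\<close>, this representative falls before
  \<open>b\<close>.\<close>

lemma int_interval_residue:
  fixes a b :: int
  assumes ab: "a < b" "b - a < int n" and i: "i \<in> arc (nat (a mod int n)) (nat (b mod int n))" "i < n"
  shows "\<exists>k. a \<le> k \<and> k < b \<and> nat (k mod int n) = i"
proof -
  have n: "0 < int n" using i by simp
  define k where "k = a + (int i - a) mod int n"
  have "k mod int n = int i"
    using i(2) by (simp add: k_def mod_simps)
  moreover have "(int i - a) mod int n < b - a"
  proof -
    define A where "A = a mod int n"
    define B where "B = b mod int n"
    have AB: "0 \<le> A" "A < int n" "0 \<le> B" "B < int n" using n by (auto simp: A_def B_def)
    have "(int i - a) mod int n = (int i - A) mod int n" by (simp add: A_def mod_simps)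
    also have "\<dots> = (if A \<le> int i then int i - A else int i - A + int n)"
      using AB i(2) by (intro mod_diff_if) auto
    finally have 1: "(int i - a) mod int n = (if A \<le> int i then int i - A else int i - A + int n)" .
    have "b - a = (b - a) mod int n" using ab by simp
    also have "\<dots> = (B - A) mod int n" by (simp add: A_def B_def mod_simps)
    also have "\<dots> = (if A \<le> B then B - A else B - A + int n)"
      using AB by (intro mod_diff_if)
    finally have 2: "b - a = (if A \<le> B then B - A else B - A + int n)" .
    have "A \<noteq> B" using 2 ab by auto
    then have "nat A \<noteq> nat B" using AB by simp
    then show ?thesis
      using i(1)[folded A_def B_def] i(2) 1 2 AB unfolding arc_iff[OF \<open>nat A \<noteq> nat B\<close>]
      by (auto split: if_splits)
  qed
  moreover have "0 \<le> (int i - a) mod int n" using n by simp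
  ultimately show ?thesis
    by (intro exI[of _ k]) (auto simp: k_def)
qed

lemma first_above:
  fixes c k :: int
  assumes "Q k" "c \<le> k"
  obtains d :: nat where "Q (c + int d)" "\<And>i. c \<le> i \<Longrightarrow> i < c + int d \<Longrightarrow> \<not> Q i" "c + int d \<le> k"
proof -
  have "Q (c + int (nat (k - c)))" using assms by simp
  then obtain d where d: "Q (c + int d)" "\<And>e. Q (c + int e) \<Longrightarrow> d \<le> e"
    using exists_least_iff[of "\<lambda>d. Q (c + int d)"] by (meson linorder_not_less)
  show ?thesis
  proof
    show "Q (c + int d)" by (rule d)
    show "c + int d \<le> k" using d(2)[of "nat (k - c)"] assms by simp
    fix i assume "c \<le> i" "i < c + int d"
    then show "\<not> Q i" using d(2)[of "nat (i - c)"] by auto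
  qed
qed

lemma first_below:
  fixes c k :: int
  assumes "Q k" "k \<le> c"
  obtains d :: nat where "Q (c - int d)" "\<And>i. i \<le> c \<Longrightarrow> c - int d < i \<Longrightarrow> \<not> Q i" "k \<le> c - int d"
proof -
  obtain d where "Q (- (- c + int d))" "\<And>i. - c \<le> i \<Longrightarrow> i < - c + int d \<Longrightarrow> \<not> Q (- i)"
    "- c + int d \<le> - k"
    using first_above[of "\<lambda>i. Q (- i)" "- k" "- c"] assms by auto
  then show ?thesis
    using that[of d] by (auto dest: spec) (metis add.commute equation_minus_iff minus_diff_eq minus_less_iff neg_le_iff_le uminus_add_conv_diff)
qed

text \<open>A point inside the rectangle may replace the lower right corner: the new rectangle is
  contained in the old one and has fewer columns strictly between its sides.\<close>

lemma vacant_pair_from_positive: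
  assumes "finite A" "inj_on s A" and ab: "a \<in> A" "b \<in> A" "a \<noteq> b"
    and Q: "\<And>p. p \<in> rectangle s a b \<Longrightarrow> Q p"
  shows "\<exists>b. vacant A s a b \<and> (\<forall>p \<in> rectangle s a b. Q p)"
  using ab(2,3) Q
proof (induction "card {u \<in> A. cyc a u b}" arbitrary: b rule: less_induct)
  case less
  show ?case
  proof (cases "vacant A s a b")
    case True
    then show ?thesis using less.prems by blast
  next
    case False
    then obtain u where u: "u \<in> A" "cyc a u b" "cyc (s b) (s u) (s a)"
      using ab less.prems by (auto simp: vacant_def)
    have "{v \<in> A. cyc a v u} \<subset> {v \<in> A. cyc a v b}"
    proof
      show "{v \<in> A. cyc a v u} \<subseteq> {v \<in> A. cyc a v b}"
        using cyc_trans[OF _ u(2)] by blast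
      have "\<not> cyc a u u" by (simp add: cyc_def)
      then show "{v \<in> A. cyc a v u} \<noteq> {v \<in> A. cyc a v b}" using u by blast
    qed
    then have "card {v \<in> A. cyc a v u} < card {v \<in> A. cyc a v b}"
      using assms(1) by (intro psubset_card_mono) auto
    moreover have "rectangle s a u \<subseteq> rectangle s a b"
      using arc_split[OF u(2)] arc_split[OF u(3)] by (auto simp: rectangle_def)
    moreover have "a \<noteq> u" using u by (auto simp: cyc_def)
    ultimately show ?thesis using less.hyps[of u] u less.prems by blast
  qed
qed

text \<open>In a row, take a shortest stretch of positive coefficients that starts with a rise and
  ends with a drop. By minimality the rise propagates upwards until it meets a point of \<open>T\<close>, the
  drop downwards, and the coefficients in between stay positive.\<close>

lemma positive_rectangle:
  fixes D :: two_chain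
  assumes n: "0 < n" and nonneg: "\<And>p. 0 \<le> D p" and pos: "0 < D (i0, j0)" "i0 < n" "j0 < n"
    and T: "T \<in> generators n"
    and diff: "\<And>i j. i < n \<Longrightarrow> j < n \<Longrightarrow> mixed_diff n D (i, j) \<le> of_bool ((i, j) \<in> T)"
    and row0: "\<And>j. j < n \<Longrightarrow> \<exists>i<n. D (i, j) = 0" and col0: "\<And>i. i < n \<Longrightarrow> \<exists>j<n. D (i, j) = 0"
  shows "\<exists>a b. a < n \<and> b < n \<and> a \<noteq> b \<and> (\<forall>p \<in> rectangle (row T) a b \<inter> torus_grid n. 0 < D p)"
proof -
  \<comment> \<open>\<open>H\<close> is \<open>D\<close> lifted periodically to the integer plane,
    where stretches that wrap around the torus become ordinary intervals.\<close>
  define r where "r i = nat (i mod int n)" for i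
  define H where "H i j = D (r i, r j)" for i j
  have r_less: "r i < n" for i using n by (simp add: r_def nat_less_iff)
  have H0: "0 \<le> H i j" for i j by (simp add: H_def nonneg)
  \<comment> \<open>Only this upper bound is needed: away from \<open>T\<close> it carries a rise in
    the row below up to the row above, and a drop in the row above down to the row below.\<close>
  have mix: "H (i - 1) j + H i (j - 1) - H i j - H (i - 1) (j - 1) \<le> of_bool ((r i, r j) \<in> T)" for i j
    using diff[OF r_less[of i] r_less[of j]] prd_nat_mod[OF n]
    by (simp add: mixed_diff_def H_def r_def)
  have window: "\<exists>k. c \<le> k \<and> k < c + int n \<and> r k = i" if "i < n" for c i
  proof (intro exI conjI)
    let ?k = "c + (int i - c) mod int n"
    have "?k mod int n = int i" using that by (simp add: mod_simps)
    then show "r ?k = i" by (simp add: r_def)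
  qed (use n in simp_all)
  have rowz: "\<exists>k. c \<le> k \<and> k < c + int n \<and> H k j = 0" for c j
    using row0[OF r_less[of j]] window[of _ c] unfolding H_def by metis
  have colz: "\<exists>k. c \<le> k \<and> k < c + int n \<and> H i k = 0" for c i
    using col0[OF r_less[of i]] window[of _ c] unfolding H_def by metis
  define seg where "seg j a b \<longleftrightarrow> a < b \<and> H (a - 1) j < H a j \<and> H b j < H (b - 1) j \<and>
    (\<forall>i. a \<le> i \<and> i < b \<longrightarrow> 0 < H i j)" for j a b
  have "\<exists>j a b. seg j a b"
  proof -
    have p: "0 < H (int i0) (int j0)" using pos by (simp add: H_def r_def)
    obtain k1 where k1: "int i0 - int n \<le> k1" "k1 < int i0" "H k1 (int j0) = 0"
      using rowz[of "int i0 - int n" "int j0"] by auto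
    obtain k2 where k2: "int i0 \<le> k2" "H k2 (int j0) = 0"
      using rowz[of "int i0" "int j0"] by auto
    obtain d1 where d1: "H (int i0 - int d1) (int j0) = 0"
      "\<And>i. i \<le> int i0 \<Longrightarrow> int i0 - int d1 < i \<Longrightarrow> H i (int j0) \<noteq> 0"
      using first_below[of "\<lambda>i. H i (int j0) = 0" k1 "int i0"] k1 by auto
    obtain d2 where d2: "H (int i0 + int d2) (int j0) = 0"
      "\<And>i. int i0 \<le> i \<Longrightarrow> i < int i0 + int d2 \<Longrightarrow> H i (int j0) \<noteq> 0"
      using first_above[of "\<lambda>i. H i (int j0) = 0" k2 "int i0"] k2 by auto
    have d: "d1 \<noteq> 0" "d2 \<noteq> 0"
      using d1(1) d2(1) p by (metis of_nat_0 diff_zero add.right_neutral less_irrefl)+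
    have all: "0 < H i (int j0)" if "int i0 - int d1 < i" "i < int i0 + int d2" for i
      using d1(2)[of i] d2(2)[of i] that H0[of i "int j0"] by linarith
    have "0 < H (int i0 - int d1 + 1) (int j0)" "0 < H (int i0 + int d2 - 1) (int j0)"
      using d by (auto intro!: all)
    then have "seg (int j0) (int i0 - int d1 + 1) (int i0 + int d2)"
      using d d1(1) d2(1) all by (auto simp: seg_def)
    then show ?thesis by blast
  qed
  then obtain j a b where seg: "seg j a b" and min: "\<And>j' a' b'. seg j' a' b' \<Longrightarrow> b - a \<le> b' - a'"
  proof -
    assume "\<exists>j a b. seg j a b" and *: "\<And>j a b. seg j a b \<Longrightarrow>
      (\<And>j' a' b'. seg j' a' b' \<Longrightarrow> b - a \<le> b' - a') \<Longrightarrow> thesis"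
    then obtain t where t: "case t of (j, a, b) \<Rightarrow> seg j a b"
      and least: "\<And>t'. (case t' of (j, a, b) \<Rightarrow> seg j a b) \<Longrightarrow>
        (case t of (j, a, b) \<Rightarrow> nat (b - a)) \<le> (case t' of (j, a, b) \<Rightarrow> nat (b - a))"
      using ex_has_least_nat[of "\<lambda>(j, a, b). seg j a b" _ "\<lambda>(j, a, b). nat (b - a)"] by fast
    obtain j a b where "t = (j, a, b)" by (cases t)
    then show thesis
      using *[of j a b] t least[of "(_, _, _)"] by (force simp: seg_def)
  qed
  have ab: "a < b" and rise: "H (a - 1) j < H a j" and drop: "H b j < H (b - 1) j"
    and posj: "\<And>i. a \<le> i \<Longrightarrow> i < b \<Longrightarrow> 0 < H i j"
    using seg by (auto simp: seg_def)
  define P where "P k \<longleftrightarrow> (\<forall>i. a \<le> i \<and> i < b \<longrightarrow> 0 < H i k)" for k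
  have up: "P (k + 1) \<and> H (a - 1) (k + 1) < H a (k + 1)"
    if "P k" "H (a - 1) k < H a k" "(r a, r (k + 1)) \<notin> T" for k
  proof -
    have rise: "H (a - 1) (k + 1) < H a (k + 1)" using mix[of a "k + 1"] that by simp
    moreover have "P (k + 1)"
    proof (rule ccontr)
      assume "\<not> P (k + 1)"
      then obtain i where i: "a \<le> i" "i < b" "H i (k + 1) = 0"
        using H0 unfolding P_def by (metis order_le_less)
      obtain d where d: "H (a + int d) (k + 1) = 0" "a + int d \<le> i"
        "\<And>i'. a \<le> i' \<Longrightarrow> i' < a + int d \<Longrightarrow> H i' (k + 1) \<noteq> 0"
        using first_above[of "\<lambda>i. H i (k + 1) = 0" i a] i by auto
      have "0 < H a (k + 1)" using rise H0[of "a - 1" "k + 1"] by linarith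
      then have "d \<noteq> 0" using d(1) by (metis add.right_neutral less_irrefl of_nat_0)
      have all: "0 < H i' (k + 1)" if "a \<le> i'" "i' < a + int d" for i'
        using d(3)[of i'] that H0[of i' "k + 1"] by linarith
      moreover have "0 < H (a + int d - 1) (k + 1)"
        using \<open>d \<noteq> 0\<close> by (auto intro!: all)
      ultimately have "seg (k + 1) a (a + int d)"
        using \<open>d \<noteq> 0\<close> rise d(1) all by (auto simp: seg_def)
      then show False using min[of "k + 1" a "a + int d"] d(2) i by linarith
    qed
    ultimately show ?thesis by blast
  qed
  have down: "P (k - 1) \<and> H b (k - 1) < H (b - 1) (k - 1)"
    if "P k" "H b k < H (b - 1) k" "(r b, r k) \<notin> T" for k
  proof -
    have drop: "H b (k - 1) < H (b - 1) (k - 1)" using mix[of b k] that by simp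
    moreover have "P (k - 1)"
    proof (rule ccontr)
      assume "\<not> P (k - 1)"
      then obtain i where i: "a \<le> i" "i < b" "H i (k - 1) = 0"
        using H0 unfolding P_def by (metis order_le_less)
      obtain d where d: "H (b - 1 - int d) (k - 1) = 0" "i \<le> b - 1 - int d"
        "\<And>i'. i' \<le> b - 1 \<Longrightarrow> b - 1 - int d < i' \<Longrightarrow> H i' (k - 1) \<noteq> 0"
        using first_below[of "\<lambda>i. H i (k - 1) = 0" i "b - 1"] i by auto
      have "0 < H (b - 1) (k - 1)" using drop H0[of b "k - 1"] by linarith
      then have "d \<noteq> 0" using d(1) by (metis diff_zero less_irrefl of_nat_0)
      have all: "0 < H i' (k - 1)" if "b - 1 - int d < i'" "i' < b" for i'
        using d(3)[of i'] that H0[of i' "k - 1"] by linarith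
      moreover have "0 < H (b - int d) (k - 1)"
        using \<open>d \<noteq> 0\<close> by (auto intro!: all)
      moreover have "H (b - int d - 1) (k - 1) = 0"
        using d(1) by (simp add: algebra_simps)
      ultimately have "seg (k - 1) (b - int d) b"
        using \<open>d \<noteq> 0\<close> drop all unfolding seg_def by auto
      then show False using min[of "k - 1" "b - int d" b] d(2) i by linarith
    qed
    ultimately show ?thesis by blast
  qed
  have Pj: "P j" using posj by (simp add: P_def)
  obtain u where u: "(r a, r (j + int u + 1)) \<in> T" "\<And>k. k \<le> u \<Longrightarrow> P (j + int k)"
  proof -
    have *: "(\<forall>k<u. (r a, r (j + int k + 1)) \<notin> T) \<Longrightarrow>
        P (j + int u) \<and> H (a - 1) (j + int u) < H a (j + int u)" for u
    proof (induction u)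
      case 0
      then show ?case using Pj rise by simp
    next
      case (Suc u)
      then show ?case using up[of "j + int u"] by (simp add: algebra_simps)
    qed
    have "\<exists>u. (r a, r (j + int u + 1)) \<in> T"
    proof (rule ccontr)
      assume "\<nexists>u. (r a, r (j + int u + 1)) \<in> T"
      then have "P (j + int u)" for u using * by blast
      then have "0 < H a (j + int u)" for u using ab by (auto simp: P_def)
      moreover obtain k where "j \<le> k" "H a k = 0" using colz[of j a] by auto
      ultimately show False by (metis le_add_diff_inverse less_irrefl nonneg_int_cases diff_ge_0_iff_ge)
    qed
    then obtain u where "(r a, r (j + int u + 1)) \<in> T" "\<And>k. k < u \<Longrightarrow> (r a, r (j + int k + 1)) \<notin> T"
      using exists_least_iff[of "\<lambda>u. (r a, r (j + int u + 1)) \<in> T"] by blast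
    then show ?thesis using that[of u] * by (meson order_less_le_trans)
  qed
  obtain v where v: "(r b, r (j - int v)) \<in> T" "\<And>k. k \<le> v \<Longrightarrow> P (j - int k)"
  proof -
    have *: "(\<forall>k<u. (r b, r (j - int k)) \<notin> T) \<Longrightarrow>
        P (j - int u) \<and> H b (j - int u) < H (b - 1) (j - int u)" for u
    proof (induction u)
      case 0
      then show ?case using Pj drop by simp
    next
      case (Suc u)
      then show ?case using down[of "j - int u"] by (simp add: algebra_simps)
    qed
    have "\<exists>u. (r b, r (j - int u)) \<in> T"
    proof (rule ccontr)
      assume "\<nexists>u. (r b, r (j - int u)) \<in> T"
      then have "P (j - int u)" for u using * by blast
      then have "0 < H a (j - int u)" for u using ab by (auto simp: P_def)
      moreover obtain k where "k < j" "H a k = 0" using colz[of "j - int n" a] by auto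
      ultimately show False by (metis diff_diff_eq2 add_diff_cancel_left' less_imp_le less_irrefl nonneg_int_cases diff_ge_0_iff_ge)
    qed
    then obtain u where "(r b, r (j - int u)) \<in> T" "\<And>k. k < u \<Longrightarrow> (r b, r (j - int k)) \<notin> T"
      using exists_least_iff[of "\<lambda>u. (r b, r (j - int u)) \<in> T"] by blast
    then show ?thesis using that[of u] * by (meson order_less_le_trans)
  qed
  define k0 k1 where "k0 = j - int v" and "k1 = j + int u + 1"
  have block: "0 < H i k" if "a \<le> i" "i < b" "k0 \<le> k" "k < k1" for i k
  proof (cases "j \<le> k")
    case True
    then show ?thesis using u(2)[of "nat (k - j)"] that by (auto simp: P_def k1_def)
  next
    case False
    then show ?thesis using v(2)[of "nat (j - k)"] that by (auto simp: P_def k0_def)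
  qed
  \<comment> \<open>Each row has a zero in every window of length \<open>n\<close>, but none in
    \<open>[a, b)\<close>; this makes the block embed in the torus.\<close>
  have width: "b - a < int n"
    using rowz[of a j] posj by (smt (verit))
  have height: "k1 - k0 < int n"
  proof -
    obtain k where "k0 \<le> k" "k < k0 + int n" "H a k = 0" using colz[of k0 a] by blast
    then show ?thesis using block[of a k] ab by (cases "k < k1") auto
  qed
  have "row T (r a) = r k1" "row T (r b) = r k0"
    using u(1) v(1) mem_generator[OF T] by (auto simp: k0_def k1_def)
  moreover have "r a \<noteq> r b"
  proof
    assume "r a = r b"
    then have "a mod int n = b mod int n" using n by (simp add: r_def nat_eq_iff)
    then have "int n dvd b - a" by (metis mod_eq_dvd_iff)
    then show False using width ab zdvd_imp_le[of "int n" "b - a"] by simp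
  qed
  moreover have "0 < D (i, k)" if ik: "i \<in> arc (r a) (r b)" "k \<in> arc (r k0) (r k1)" "i < n" "k < n" for i k
  proof -
    obtain i' where "a \<le> i'" "i' < b" "r i' = i"
      using int_interval_residue[OF ab width, of i] ik by (auto simp: r_def)
    moreover obtain k' where "k0 \<le> k'" "k' < k1" "r k' = k"
      using int_interval_residue[OF _ height, of k] ik by (auto simp: r_def k0_def k1_def)
    ultimately show ?thesis using block[of i' k'] by (simp add: H_def)
  qed
  ultimately show ?thesis
    using r_less by (intro exI[of _ "r a"] exI[of _ "r b"]) (auto simp: rectangle_def torus_grid_def)
qed

section \<open>A discrete Lipshitz index and the description of covers by rectangles\<close>

section \<open>Grading and covering relations\<close>

text \<open>Four times the average multiplicity of \<open>D\<close> at a grid point, kept undivided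
  to remain in the integers.\<close>

definition corner_sum :: "nat \<Rightarrow> two_chain \<Rightarrow> nat \<times> nat \<Rightarrow> int" where
  "corner_sum n D = (\<lambda>(i, j). D (i, j) + D (prd n i, j) + D (i, prd n j) + D (prd n i, prd n j))"

text \<open>Four times the point measure at a generator. Summing over the whole grid with an
  indicator makes it comparable with the bilinear form below.\<close>

definition point_measure :: "nat \<Rightarrow> (nat \<times> nat) set \<Rightarrow> two_chain \<Rightarrow> int" where
  "point_measure n S D = (\<Sum>i<n. \<Sum>j<n. of_bool ((i, j) \<in> S) * corner_sum n D (i, j))"

lemma sum_prd: "(\<Sum>i<n. f (prd n i)) = (\<Sum>i<n. f i)"
  using sum.reindex_bij_betw[OF bij_betw_prd] by blast

text \<open>Summation by parts: the first operator is antisymmetric in each of the two directions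
  after composition with the second one, hence the form is symmetric.\<close>

lemma mixed_diff_corner_sum_commute:
  "(\<Sum>i<n. \<Sum>j<n. mixed_diff n D (i, j) * corner_sum n E (i, j)) =
   (\<Sum>i<n. \<Sum>j<n. mixed_diff n E (i, j) * corner_sum n D (i, j))"
proof -
  let ?p = "prd n"
  define h where "h D E = (\<Sum>i<n. \<Sum>j<n. D (?p i, j) * E (i, j) :: int)" for D E :: two_chain
  define v where "v D E = (\<Sum>i<n. \<Sum>j<n. D (i, ?p j) * E (i, j) :: int)" for D E :: two_chain
  have h': "(\<Sum>i<n. \<Sum>j<n. D (?p i, ?p j) * E (i, ?p j)) = h D E" for D E
    unfolding h_def by (rule sum.cong[OF refl], rule sum_prd)
  have v': "(\<Sum>i<n. \<Sum>j<n. D (?p i, ?p j) * E (?p i, j)) = v D E" for D E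
    unfolding v_def using sum_prd[of "\<lambda>i. \<Sum>j<n. D (i, ?p j) * E (i, j)" n] .
  have expand: "mixed_diff n D (i, j) * corner_sum n E (i, j) - mixed_diff n E (i, j) * corner_sum n D (i, j) =
     2 * (D (?p i, j) * E (i, j) + D (?p i, j) * E (?p i, ?p j) + D (i, ?p j) * E (i, j) + D (i, ?p j) * E (?p i, ?p j)
        - E (?p i, j) * D (i, j) - E (?p i, j) * D (?p i, ?p j) - E (i, ?p j) * D (i, j) - E (i, ?p j) * D (?p i, ?p j))" for i j
    by (simp add: mixed_diff_def corner_sum_def algebra_simps)
  have "(\<Sum>i<n. \<Sum>j<n. mixed_diff n D (i, j) * corner_sum n E (i, j)) -
      (\<Sum>i<n. \<Sum>j<n. mixed_diff n E (i, j) * corner_sum n D (i, j)) =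
      (\<Sum>i<n. \<Sum>j<n. mixed_diff n D (i, j) * corner_sum n E (i, j)
        - mixed_diff n E (i, j) * corner_sum n D (i, j))"
    by (simp only: sum_subtractf)
  also have "\<dots> = 2 * (h D E + v E D + v D E + h E D - h E D - v D E - v E D - h D E)"
    unfolding expand sum_distrib_left[symmetric] sum.distrib sum_subtractf
    using h'[of D E] h'[of E D] v'[of D E] v'[of E D] unfolding h_def v_def
    by (simp add: mult.commute)
  finally show ?thesis by simp
qed

lemma point_measure_add:
  "point_measure n S (\<lambda>p. D p + E p) = point_measure n S D + point_measure n S E"
  by (simp add: point_measure_def corner_sum_def sum.distrib[symmetric] algebra_simps)

lemma point_measure_graph:
  assumes "\<And>i. i < n \<Longrightarrow> s i < n"
  shows "point_measure n (graph n s) D = (\<Sum>i<n. corner_sum n D (i, s i))"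
  unfolding point_measure_def
proof (intro sum.cong refl)
  fix i assume "i \<in> {..<n}"
  then have "(\<Sum>j<n. of_bool ((i, j) \<in> graph n s) * corner_sum n D (i, j)) =
      (\<Sum>j<n. if j = s i then corner_sum n D (i, j) else 0)"
    by (intro sum.cong) auto
  then show "(\<Sum>j<n. of_bool ((i, j) \<in> graph n s) * corner_sum n D (i, j)) = corner_sum n D (i, s i)"
    using assms[of i] \<open>i \<in> {..<n}\<close> by (simp add: sum.delta)
qed

lemma corner_sum_rect_chain:
  assumes "i < n" "j < n"
  shows "corner_sum n (rect_chain n s a b) (i, j) =
    (of_bool (i \<in> arc a b) + of_bool (prd n i \<in> arc a b)) *
    (of_bool (j \<in> arc (s b) (s a)) + of_bool (prd n j \<in> arc (s b) (s a)))"
  using assms prd_less[of i n] prd_less[of j n]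
  by (simp add: corner_sum_def rect_chain_eq algebra_simps)

lemma arc_prd_corner:
  assumes "i < n" "a < n" "b < n" "a \<noteq> b"
  shows "of_bool (i \<in> arc a b) + of_bool (prd n i \<in> arc a b) =
    (if i = a \<or> i = b then 1 else 2 * of_bool (cyc a i b) :: int)"
proof -
  have "i \<in> arc a b \<longleftrightarrow> i = a \<or> cyc a i b" "\<not> cyc a a b" "\<not> cyc a b b"
    using assms(4) by (auto simp: arc_def cyc_def)
  then show ?thesis
    using arc_prd[OF assms] assms(4) by (auto simp: of_bool_def split: if_splits)
qed

text \<open>Exactly one of the four cells at a corner lies in the rectangle. Any other coordinate
  shares no row or column with the corners and lies outside the rectangle, so none of its four cells
  does.\<close>

lemma vacant_corner_sum:
  assumes S: "S \<in> generators n" and v: "vacant {..<n} (row S) a b" and i: "i < n"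
  shows "corner_sum n (rect_chain n (row S) a b) (i, row S i) = of_bool (i = a \<or> i = b)"
    "corner_sum n (rect_chain n (row S) a b) (i, swap a b (row S) i) = of_bool (i = a \<or> i = b)"
proof -
  have ab: "a < n" "b < n" "a \<noteq> b" using v by (auto simp: vacant_def)
  have ne: "row S a \<noteq> row S b" using inj_on_row[OF S] ab by (auto simp: inj_on_def)
  have less: "row S u < n" if "u < n" for u using row_less[OF S that] .
  have *: "corner_sum n (rect_chain n (row S) a b) (i, j) =
      (if i = a \<or> i = b then 1 else 2 * of_bool (cyc a i b)) *
      (if j = row S b \<or> j = row S a then 1 else 2 * of_bool (cyc (row S b) j (row S a)))" if "j < n" for j
    using corner_sum_rect_chain[OF i that] arc_prd_corner[OF i ab]
      arc_prd_corner[OF that less[OF ab(2)] less[OF ab(1)] ne[symmetric]] by simp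
  have 0: "(2 * of_bool (cyc a i b)) * (if row S i = row S b \<or> row S i = row S a then 1
      else 2 * of_bool (cyc (row S b) (row S i) (row S a))) = (0 :: int)" if "i \<noteq> a" "i \<noteq> b"
    using v i that inj_on_row[OF S] ab by (auto simp: vacant_def inj_on_def)
  show "corner_sum n (rect_chain n (row S) a b) (i, row S i) = of_bool (i = a \<or> i = b)"
    using *[OF less[OF i]] 0 by auto
  show "corner_sum n (rect_chain n (row S) a b) (i, swap a b (row S) i) = of_bool (i = a \<or> i = b)"
    using *[OF less[OF ab(1)]] *[OF less[OF ab(2)]] *[OF less[OF i]] 0 by (cases "i = a"; cases "i = b") auto
qed

lemma point_measure_vacant:
  assumes S: "S \<in> generators n" and v: "vacant {..<n} (row S) a b"
  shows "point_measure n S (rect_chain n (row S) a b) = 2"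
    "point_measure n (graph n (swap a b (row S))) (rect_chain n (row S) a b) = 2"
proof -
  have ab: "a < n" "b < n" "a \<noteq> b" using v by (auto simp: vacant_def)
  have "(\<Sum>i<n. of_bool (i = a \<or> i = b)) = (\<Sum>i\<in>{a, b}. 1 :: int)"
    using ab by (intro sum.mono_neutral_cong_right) auto
  then have two: "(\<Sum>i<n. of_bool (i = a \<or> i = b)) = (2 :: int)" using ab by simp
  show "point_measure n S (rect_chain n (row S) a b) = 2"
    using point_measure_graph[of n "row S"] graph_row[OF S] row_less[OF S] vacant_corner_sum(1)[OF S v] two
    by simp
  have "swap a b (row S) i < n" if "i < n" for i
    using row_less[OF S] that ab by (auto simp: swap_def)
  then show "point_measure n (graph n (swap a b (row S))) (rect_chain n (row S) a b) = 2"
    using point_measure_graph[of n "swap a b (row S)"] vacant_corner_sum(2)[OF S v] two by simp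
qed

context grid
begin

definition index :: "grid_element \<Rightarrow> grid_element \<Rightarrow> two_chain \<Rightarrow> int" where
  "index x y D = point_measure n (fst x) D + point_measure n (fst y) D"

lemma mixed_diff_point_measure:
  assumes "D \<in> doms x y"
  shows "(\<Sum>i<n. \<Sum>j<n. mixed_diff n D (i, j) * corner_sum n E (i, j)) =
    point_measure n (fst y) E - point_measure n (fst x) E"
  using assms unfolding dom_iff point_measure_def
  by (simp add: left_diff_distrib sum_subtractf)

text \<open>The cross terms are the change from \<open>x\<close> to \<open>y\<close> of the point
  measure of \<open>E\<close> and the change from \<open>y\<close> to \<open>z\<close> of that of
  \<open>D\<close>. Since mixed differences record these changes, the two terms are the two sides of
  the symmetric form and cancel.\<close>

lemma index_add:
  assumes "D \<in> doms x y" "E \<in> doms y z"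
  shows "index x z (\<lambda>p. D p + E p) = index x y D + index y z E"
  using mixed_diff_point_measure[OF assms(1), of E] mixed_diff_point_measure[OF assms(2), of D]
    mixed_diff_corner_sum_commute[of n D E]
  by (simp add: index_def point_measure_add)

definition step :: "grid_element \<Rightarrow> nat \<Rightarrow> nat \<Rightarrow> grid_element \<Rightarrow> bool" where
  "step y a b x \<longleftrightarrow> x \<in> G \<and> y \<in> G \<and> vacant {..<n} (row (fst y)) a b \<and>
    fst x = graph n (swap a b (row (fst y))) \<and> rect_chain n (row (fst y)) a b \<in> doms x y"

lemma step_index: "step y a b x \<Longrightarrow> index x y (rect_chain n (row (fst y)) a b) = 4"
  using point_measure_vacant by (auto simp: step_def index_def G_iff)

lemma rect_chain_nonneg: "0 \<le> rect_chain n s a b p"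
  by (simp add: rect_chain_def)

lemma rect_chain_neq_0: "vacant {..<n} (row S) a b \<Longrightarrow> S \<in> generators n \<Longrightarrow> rect_chain n (row S) a b \<noteq> (\<lambda>_. 0)"
proof -
  assume v: "vacant {..<n} (row S) a b" and S: "S \<in> generators n"
  then have ab: "a < n" "b < n" "a \<noteq> b" by (auto simp: vacant_def)
  then have "row S a \<noteq> row S b" using inj_on_row[OF S] by (auto simp: inj_on_def)
  then have "rect_chain n (row S) a b (a, row S b) = 1"
    using ab row_less[OF S] by (simp add: rect_chain_eq arc_def)
  then show ?thesis by (auto dest: fun_cong)
qed

text \<open>Cuts a rectangle off at the lower end of a domain; the difference remains a positive
  domain because the rectangle fits under \<open>D\<close>.\<close>

lemma stepI:
  assumes x: "x \<in> G" and y: "y \<in> G" and D: "D \<in> doms x y"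
    and v: "vacant {..<n} (row (fst y)) a b" and R: "\<And>p. rect_chain n (row (fst y)) a b p \<le> D p"
  obtains z where "step y a b z" "(\<lambda>p. D p - rect_chain n (row (fst y)) a b p) \<in> doms x z"
    "z \<in> G" "le y z" "le z x"
proof -
  let ?R = "rect_chain n (row (fst y)) a b"
  have ab: "a < n" "b < n" "a \<noteq> b" using v by (auto simp: vacant_def)
  have gen: "fst y \<in> generators n" using y by (simp add: G_iff)
  \<comment> \<open>The exponents are forced by the O markings. There the rectangle is at most
    \<open>D\<close>, hence at most the exponent of \<open>y\<close>, so the truncated subtraction
    is exact.\<close>
  define z where "z = (graph n (swap a b (row (fst y))), \<lambda>i. if i < n then snd y i - nat (?R (Os i)) else 0)"
  have zG: "z \<in> G" using graph_swap_generators[OF gen ab(1,2)] by (simp add: z_def G_iff)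
  have RO: "?R (Os i) \<le> int (snd y i)" if "i < n" for i
    using R[of "Os i"] D that by (auto simp: dom_iff)
  have RX: "?R (Xs i) = 0" if "i < n" for i
    using R[of "Xs i"] D that rect_chain_nonneg[of "row (fst y)" a b "Xs i"] by (auto simp: dom_iff)
  have "?R \<in> domains n (fst z) (fst y)"
    using rect_chain_domains[OF gen ab] by (simp add: z_def)
  then have Rz: "?R \<in> doms z y"
    using RO RX rect_chain_nonneg by (auto simp: element_domains_def z_def of_nat_diff nat_le_iff)
  have st: "step y a b z"
    using zG y v Rz by (simp add: step_def z_def)
  have Dz: "(\<lambda>p. D p - ?R p) \<in> doms x z"
    by (rule dom_diff[OF D Rz])
  show ?thesis
    using that[OF st Dz zG leI[OF Rz] leI[OF Dz]] R rect_chain_nonneg by simp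
qed

lemma ex_step:
  assumes x: "x \<in> G" and y: "y \<in> G" and D: "D \<in> doms x y" "\<And>p. 0 \<le> D p" "D \<noteq> (\<lambda>_. 0)"
  obtains a b where "vacant {..<n} (row (fst y)) a b" "\<And>p. rect_chain n (row (fst y)) a b p \<le> D p"
proof -
  have gen: "fst y \<in> generators n" using y by (simp add: G_iff)
  obtain p where "D p \<noteq> 0" using D(3) by (meson ext)
  moreover have "p \<in> torus_grid n"
    using D(1) \<open>D p \<noteq> 0\<close> unfolding dom_iff two_chains_def by blast
  ultimately obtain i0 j0 where p: "0 < D (i0, j0)" "i0 < n" "j0 < n"
    using D(2)[of p] by (cases p) (auto simp: torus_grid_def less_le)
  \<comment> \<open>The X markings provide the zero in each row and each column that
    \<open>positive_rectangle\<close> needs.\<close>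
  have X0: "D q = 0" if "q \<in> Xs ` {..<n}" for q
    using that D(1) by (auto simp: dom_iff)
  have "\<exists>a b. a < n \<and> b < n \<and> a \<noteq> b \<and> (\<forall>p \<in> rectangle (row (fst y)) a b \<inter> torus_grid n. 0 < D p)"
  proof (rule positive_rectangle[where D = D, OF n_pos D(2) p gen])
    show "mixed_diff n D (i, j) \<le> of_bool ((i, j) \<in> fst y)" if "i < n" "j < n" for i j
      using D(1) that by (simp add: dom_iff)
    show "\<exists>i<n. D (i, j) = 0" if "j < n" for j using ex_X_row[OF that] X0 by metis
    show "\<exists>j<n. D (i, j) = 0" if "i < n" for i using ex_X_col[OF that] X0 by metis
  qed
  then obtain a c where "a < n" "c < n" "a \<noteq> c"
    "\<forall>p \<in> rectangle (row (fst y)) a c \<inter> torus_grid n. 0 < D p" by blast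
  then obtain b where "vacant {..<n} (row (fst y)) a b"
    "\<forall>p \<in> rectangle (row (fst y)) a b. p \<in> torus_grid n \<longrightarrow> 0 < D p"
    using vacant_pair_from_positive[of "{..<n}" "row (fst y)" a c "\<lambda>p. p \<in> torus_grid n \<longrightarrow> 0 < D p"]
      inj_on_row[OF gen] by auto
  then show ?thesis
    using that[of a b] D(2) by (force simp: rect_chain_def int_one_le_iff_zero_less)
qed

text \<open>The number \<open>m\<close> counts the rectangles cut off one after another, with
  induction on the total multiplicity. For \<open>m \<ge> 2\<close> the first cut leaves a remainder
  of nonzero index, so its intermediate element lies strictly between.\<close>

lemma index_nat:
  assumes "x \<in> G" "y \<in> G" "D \<in> doms x y" "\<And>p. 0 \<le> D p"
  shows "\<exists>m::nat. index x y D = 4 * int m \<and> (m = 0 \<longrightarrow> x = y) \<and>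
    (2 \<le> m \<longrightarrow> (\<exists>z\<in>G. le y z \<and> le z x \<and> z \<noteq> y \<and> z \<noteq> x))"
  using assms
proof (induction "nat (\<Sum>p\<in>torus_grid n. D p)" arbitrary: D y rule: less_induct)
  case less
  show ?case
  proof (cases "D = (\<lambda>_. 0)")
    case True
    then show ?thesis
      using dom_0_eq less.prems by (intro exI[of _ 0]) (auto simp: index_def point_measure_def corner_sum_def)
  next
    case False
    from ex_step[OF less.prems(1-4) False] obtain a b where
      v: "vacant {..<n} (row (fst y)) a b" and R: "\<And>p. rect_chain n (row (fst y)) a b p \<le> D p" by blast
    from stepI[OF less.prems(1-3) v R] obtain z where
      z: "step y a b z" "(\<lambda>p. D p - rect_chain n (row (fst y)) a b p) \<in> doms x z" "z \<in> G" "le y z" "le z x" by blast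
    let ?R = "rect_chain n (row (fst y)) a b"
    have gen: "fst y \<in> generators n" using less.prems by (simp add: G_iff)
    have Rz: "?R \<in> doms z y" using z(1) by (simp add: step_def)
    obtain q where q: "?R q \<noteq> 0" using rect_chain_neq_0[OF v gen] by (meson ext)
    then have "0 < ?R q" and qt: "q \<in> torus_grid n" using rect_chain_nonneg[of _ a b q]
      by (auto simp: rect_chain_def)
    then have "0 < (\<Sum>p\<in>torus_grid n. ?R p)"
      using rect_chain_nonneg by (intro sum_pos2[of _ q]) (auto simp: torus_grid_def)
    moreover have "0 \<le> (\<Sum>p\<in>torus_grid n. D p - ?R p)" using R by (intro sum_nonneg) simp
    ultimately have "nat (\<Sum>p\<in>torus_grid n. D p - ?R p) < nat (\<Sum>p\<in>torus_grid n. D p)"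
      by (simp add: sum_subtractf)
    from less.hyps[OF this less.prems(1) z(3) z(2)] R obtain m where
      m: "index x z (\<lambda>p. D p - ?R p) = 4 * int m" "m = 0 \<longrightarrow> x = z" by auto
    have "index x y (\<lambda>p. D p - ?R p + ?R p) = 4 * int m + 4"
      using index_add[OF z(2) Rz] m step_index[OF z(1)] by simp
    then have ind: "index x y D = 4 * int (Suc m)" by simp
    have "z \<noteq> y"
      using dom_unique[OF Rz, of "\<lambda>_. 0"] dom_0 rect_chain_neq_0[OF v gen] by blast
    moreover have "z \<noteq> x" if "m \<noteq> 0"
    proof
      assume "z = x"
      then have "(\<lambda>p. D p - ?R p) = (\<lambda>_. 0)" using dom_unique[OF z(2)] dom_0 by blast
      then have "index x z (\<lambda>p. D p - ?R p) = 0"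
        by (simp add: index_def point_measure_def corner_sum_def)
      then show False using m that by simp
    qed
    ultimately show ?thesis
      using ind z by (intro exI[of _ "Suc m"]) auto
  qed
qed

text \<open>Meaningful for comparable elements, where the domain exists, is unique, and has index
  divisible by 4.\<close>

definition grid_rank :: "grid_element \<Rightarrow> grid_element \<Rightarrow> nat" where
  "grid_rank y x = nat (index x y (THE D. D \<in> doms x y)) div 4"

lemma The_doms: "D \<in> doms x y \<Longrightarrow> (THE D. D \<in> doms x y) = D"
  using dom_unique by blast

lemma grid_rank_eq:
  assumes "x \<in> G" "y \<in> G" "D \<in> doms x y" "\<And>p. 0 \<le> D p"
  shows "index x y D = 4 * int (grid_rank y x)"
  using index_nat[OF assms] The_doms[OF assms(3)] by (auto simp: grid_rank_def)

sublocale ranked_poset G le grid_rank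
proof
  show "grid_rank a c = grid_rank a b + grid_rank b c"
    if abc: "a \<in> G" "b \<in> G" "c \<in> G" "le a b" "le b c" for a b c
  proof -
    obtain D E where D: "D \<in> doms b a" "\<And>p. 0 \<le> D p" and E: "E \<in> doms c b" "\<And>p. 0 \<le> E p"
      using abc by (auto elim!: leE)
    have "index c a (\<lambda>p. E p + D p) = 4 * int (grid_rank a c)"
      using abc D E by (intro grid_rank_eq dom_add[OF E(1) D(1)]) (auto intro: add_nonneg_nonneg)
    then show ?thesis
      using index_add[OF E(1) D(1)] grid_rank_eq[OF _ _ D] grid_rank_eq[OF _ _ E] abc by simp
  qed
  show "a = b" if ab: "a \<in> G" "b \<in> G" "le a b" "grid_rank a b = 0" for a b
  proof -
    obtain D where D: "D \<in> doms b a" "\<And>p. 0 \<le> D p" using ab by (auto elim!: leE)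
    show ?thesis using index_nat[OF ab(2,1) D] grid_rank_eq[OF ab(2,1) D] ab(4) by auto
  qed
  show "\<exists>z\<in>G. le a z \<and> le z b \<and> z \<noteq> a \<and> z \<noteq> b"
    if ab: "a \<in> G" "b \<in> G" "le a b" "2 \<le> grid_rank a b" for a b
  proof -
    obtain D where D: "D \<in> doms b a" "\<And>p. 0 \<le> D p" using ab by (auto elim!: leE)
    show ?thesis using index_nat[OF ab(2,1) D] grid_rank_eq[OF ab(2,1) D] ab(4) by auto
  qed
qed (use grid_le_refl grid_le_trans grid_le_antisym in blast)+

text \<open>The domain of a cover has room for a rectangle, and cutting it off yields an element
  above \<open>y\<close> and different from it, which must be \<open>x\<close>. Conversely a
  rectangle has rank 1, which cannot be split.\<close>

lemma covered_by_iff: "covered_by G le y x \<longleftrightarrow> (\<exists>a b. step y a b x)"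
proof
  assume cov: "covered_by G le y x"
  then have xy: "x \<in> G" "y \<in> G" "le y x" "y \<noteq> x" by (auto simp: covered_by_def)
  obtain D where D: "D \<in> doms x y" "\<And>p. 0 \<le> D p" using xy by (auto elim!: leE)
  have D0: "D \<noteq> (\<lambda>_. 0)" using D(1) dom_0_eq[of x y] xy by metis
  from ex_step[OF xy(1,2) D D0] obtain a b where
    v: "vacant {..<n} (row (fst y)) a b" and R: "\<And>p. rect_chain n (row (fst y)) a b p \<le> D p" by blast
  from stepI[OF xy(1,2) D(1) v R] obtain z where z: "step y a b z" "z \<in> G" "le y z" "le z x" by blast
  have "z \<noteq> y"
  proof
    assume "z = y"
    then have "rect_chain n (row (fst y)) a b = (\<lambda>_. 0)"
      using z(1) dom_unique[OF _ dom_0[of y]] by (simp add: step_def)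
    then show False using rect_chain_neq_0[OF v] xy by (auto simp: G_iff)
  qed
  then have "z = x" using cov z by (auto simp: covered_by_def)
  then show "\<exists>a b. step y a b x" using z by blast
next
  assume "\<exists>a b. step y a b x"
  then obtain a b where st: "step y a b x" by blast
  let ?R = "rect_chain n (row (fst y)) a b"
  have xy: "x \<in> G" "y \<in> G" and R: "?R \<in> doms x y" using st by (auto simp: step_def)
  have r1: "grid_rank y x = 1"
    using grid_rank_eq[OF xy R rect_chain_nonneg] step_index[OF st] by simp
  have "y \<noteq> x"
    using r1 rk_add[of y y y] grid_le_refl xy by auto
  moreover have "le y x" by (rule leI[OF R rect_chain_nonneg])
  moreover have "z = y \<or> z = x" if z: "z \<in> G" "le y z" "le z x" for z
    using rk_add[of y z x] rk_eq_0[of y z] rk_eq_0[of z x] r1 z xy by (cases "grid_rank y z") auto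
  ultimately show "covered_by G le y x"
    using xy by (auto simp: covered_by_def)
qed

end

section \<open>Labels in terms of the two columns of a rectangle\<close>

section \<open>Labels\<close>

definition width :: "nat \<Rightarrow> nat \<Rightarrow> nat \<Rightarrow> nat" where
  "width n a b = (if a < b then b - a else b + n - a)"

lemma width_bounds: "a < n \<Longrightarrow> b < n \<Longrightarrow> a \<noteq> b \<Longrightarrow> 0 < width n a b \<and> width n a b < n"
  by (auto simp: width_def)

lemma add_mod_if:
  fixes a s n :: nat
  assumes "a < n" "s < n"
  shows "(a + s) mod n = (if a + s < n then a + s else a + s - n)"
  using assms by (simp add: le_mod_geq)

text \<open>Translates the offset description of blocks into cyclic arcs.\<close>

lemma ex_offset_less_width:
  assumes "a < n" "b < n" "a \<noteq> b"
  shows "(\<exists>s. i = (a + s) mod n \<and> s < width n a b) \<longleftrightarrow> i < n \<and> i \<in> arc a b"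
proof
  assume "\<exists>s. i = (a + s) mod n \<and> s < width n a b"
  then obtain s where s: "i = (a + s) mod n" "s < width n a b" by blast
  then have "s < n" using width_bounds[OF assms] by linarith
  then have "a + s < n \<and> i = a + s \<or> n \<le> a + s \<and> i + n = a + s"
    using s(1) assms(1) by (auto simp: add_mod_if)
  then show "i < n \<and> i \<in> arc a b"
    using s(2) \<open>s < n\<close> assms unfolding width_def arc_iff[OF assms(3)] by (cases "a < b") auto
next
  assume i: "i < n \<and> i \<in> arc a b"
  define s where "s = (if a \<le> i then i - a else i + n - a)"
  have "s < n" "a + s = i \<or> a + s = i + n" using i assms by (auto simp: s_def)
  then have "i = (a + s) mod n" using i by auto
  moreover have "s < width n a b"
    using i assms unfolding width_def arc_iff[OF assms(3)] s_def by (cases "a < b"; cases "a \<le> i") auto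
  ultimately show "\<exists>s. i = (a + s) mod n \<and> s < width n a b" by blast
qed

lemma ex_offset_interior:
  assumes "a < n" "b < n" "a \<noteq> b"
  shows "(\<exists>s. i = (a + s) mod n \<and> 0 < s \<and> s < width n a b) \<longleftrightarrow> i < n \<and> cyc a i b"
proof -
  have "cyc a i b \<longleftrightarrow> i \<noteq> a \<and> i \<in> arc a b"
    by (auto simp: arc_def cyc_def)
  moreover have "(\<exists>s. i = (a + s) mod n \<and> 0 < s \<and> s < width n a b) \<longleftrightarrow>
      i \<noteq> a \<and> (\<exists>s. i = (a + s) mod n \<and> s < width n a b)"
  proof -
    have "(a + s) mod n = a \<longleftrightarrow> s = 0" if "s < width n a b" for s
      using that width_bounds[OF assms] assms by (subst add_mod_if) auto
    then show ?thesis by (metis neq0_conv)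
  qed
  ultimately show ?thesis
    using ex_offset_less_width[OF assms, of i] by blast
qed

lemma block_components_rectangle:
  assumes "a < n" "b < n" "a \<noteq> b" "s a < n" "s b < n" "s a \<noteq> s b"
  shows "block_components n a (s b) (width n a b) (width n (s b) (s a)) = rectangle s a b \<inter> torus_grid n"
proof -
  have "p \<in> block_components n a (s b) (width n a b) (width n (s b) (s a)) \<longleftrightarrow>
      (\<exists>u. fst p = (a + u) mod n \<and> u < width n a b) \<and>
      (\<exists>v. snd p = (s b + v) mod n \<and> v < width n (s b) (s a))" for p
    by (cases p) (auto simp: block_components_def)
  then show ?thesis
    using ex_offset_less_width[of a n b] ex_offset_less_width[of "s b" n "s a"] assms
    by (auto simp: rectangle_def torus_grid_def)
qed

lemma block_interior_points_iff:
  assumes "a < n" "b < n" "a \<noteq> b" "s a < n" "s b < n" "s a \<noteq> s b"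
  shows "(i, j) \<in> block_interior_points n a (s b) (width n a b) (width n (s b) (s a)) \<longleftrightarrow>
    i < n \<and> j < n \<and> cyc a i b \<and> cyc (s b) j (s a)"
proof -
  have "(i, j) \<in> block_interior_points n a (s b) (width n a b) (width n (s b) (s a)) \<longleftrightarrow>
      (\<exists>u. i = (a + u) mod n \<and> 0 < u \<and> u < width n a b) \<and>
      (\<exists>v. j = (s b + v) mod n \<and> 0 < v \<and> v < width n (s b) (s a))"
    by (auto simp: block_interior_points_def)
  then show ?thesis
    using ex_offset_interior[of a n b i] ex_offset_interior[of "s b" n "s a" j] assms by auto
qed

lemma Least_offset:
  fixes a k0 n c :: nat
  assumes "1 \<le> k0" "k0 \<le> n" "(a + k0) mod n = c"
  shows "(LEAST k. 1 \<le> k \<and> (a + k) mod n = c) = k0"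
proof (rule Least_equality)
  fix k assume k: "1 \<le> k \<and> (a + k) mod n = c"
  show "k0 \<le> k"
  proof (rule ccontr)
    assume "\<not> k0 \<le> k"
    moreover then have "n dvd (a + k0) - (a + k)"
      using k assms(3) by (metis add_le_cancel_left mod_eq_dvd_iff_nat nat_le_linear)
    ultimately show False using k assms(1,2) by (auto dest: dvd_imp_le)
  qed
qed (use assms in simp)

text \<open>Since \<open>l\<close> lies just to the right of circle \<open>l\<close>, that circle is
  the first one met going left; hence the offset \<open>l + 1\<close>.\<close>

definition left_distance :: "nat \<Rightarrow> nat \<Rightarrow> nat \<Rightarrow> nat" where
  "left_distance n l a = (if a \<le> l then l + 1 - a else l + 1 + n - a)"

definition right_distance :: "nat \<Rightarrow> nat \<Rightarrow> nat \<Rightarrow> nat" where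
  "right_distance n l a = (if l \<le> a then a - l else a + n - l)"

definition pair_label :: "nat \<Rightarrow> nat \<Rightarrow> nat \<Rightarrow> nat \<Rightarrow> nat \<times> nat \<times> nat" where
  "pair_label n l a b =
    (if l \<in> arc a b then (0, left_distance n l a, width n a b)
     else (1, right_distance n l a, width n a b))"

lemma hit_annuli_rect_chain:
  assumes "a < n" "b < n" "a \<noteq> b" "s a < n" "s b < n" "s a \<noteq> s b"
  shows "hit_annuli n (rect_chain n s a b) = arc a b \<inter> {..<n}"
proof -
  have "s b \<in> arc (s b) (s a)" using assms by (auto simp: arc_def)
  then show ?thesis
    using assms by (auto simp: hit_annuli_def rect_chain_eq)
qed

lemma card_arc:
  assumes "a < n" "b < n" "a \<noteq> b"
  shows "card (arc a b \<inter> {..<n}) = width n a b"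
proof -
  have "arc a b \<inter> {..<n} = (\<lambda>s. (a + s) mod n) ` {..<width n a b}"
    using ex_offset_less_width[OF assms] by auto
  moreover have "inj_on (\<lambda>s. (a + s) mod n) {..<width n a b}"
    using width_bounds[OF assms] assms by (auto simp: inj_on_def add_mod_if split: if_splits)
  ultimately show ?thesis by (simp add: card_image)
qed

lemma rect_triple_rect_chain:
  assumes l: "l < n" and ab: "a < n" "b < n" "a \<noteq> b" and s: "s a < n" "s b < n" "s a \<noteq> s b"
  shows "rect_triple n l (rect_chain n s a b) = pair_label n l a b"
proof -
  let ?R = "rect_chain n s a b"
  have hit: "hit_annuli n ?R = arc a b \<inter> {..<n}"
    by (rule hit_annuli_rect_chain[of a n b s, OF ab s])
  have left: "left_beta n ?R = a"
    \<comment> \<open>By \<open>arc_prd\<close> the start of an arc is its only element whose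
      predecessor is outside.\<close>
    unfolding left_beta_def hit
  proof (rule the_equality)
    show "a \<in> arc a b \<inter> {..<n} \<and> (a + n - 1) mod n \<notin> arc a b \<inter> {..<n}"
    proof -
      have "a \<in> arc a b" "prd n a \<notin> arc a b"
        using ab by (simp_all add: arc_iff prd_if) linarith
      then show ?thesis using ab by (simp add: prd_def)
    qed
    show "c = a" if "c \<in> arc a b \<inter> {..<n} \<and> (c + n - 1) mod n \<notin> arc a b \<inter> {..<n}" for c
    proof -
      have "c < n" "c \<in> arc a b" "prd n c \<notin> arc a b"
        using that prd_less[of c n] by (auto simp: prd_def)
      then show ?thesis using arc_prd[of c n a b] ab by (auto simp: of_bool_def split: if_splits)
    qed
  qed
  have t: "rect_t n ?R = width n a b"
    using card_arc[OF ab] by (simp add: rect_t_def hit)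
  show ?thesis
  proof (cases "l \<in> arc a b")
    case True
    let ?k = "if a \<le> l then l + 1 - a else l + 1 + n - a"
    have "a + ?k = l + 1 \<or> a + ?k = l + 1 + n" using ab by auto
    then have "(a + ?k) mod n = (l + 1) mod n" by (metis mod_add_self2)
    moreover have "1 \<le> ?k" "?k \<le> n" using ab l by auto
    ultimately have "(LEAST k. 1 \<le> k \<and> (a + k) mod n = (l + 1) mod n) = ?k" by (intro Least_offset)
    then show ?thesis
      using True l by (simp add: rect_triple_def rect_s_def rect_i_def hit left t pair_label_def
          left_distance_def right_distance_def)
  next
    case False
    let ?k = "if l \<le> a then a - l else a + n - l"
    have "l \<noteq> a" using False ab by (auto simp: arc_def)
    then have "l + ?k = a \<or> l + ?k = a + n" "1 \<le> ?k" "?k \<le> n" using ab l by auto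
    moreover from this(1) have "(l + ?k) mod n = a" using ab by auto
    ultimately have "(LEAST k. 1 \<le> k \<and> (l + k) mod n = a) = ?k" by (intro Least_offset)
    then show ?thesis
      using False l by (simp add: rect_triple_def rect_s_def rect_i_def hit left t pair_label_def
          left_distance_def right_distance_def)
  qed
qed

text \<open>The first entry tells which distance is meant, the distance gives the left column, and
  the thickness then gives the right one.\<close>

lemma pair_label_inj:
  assumes "l < n" "a < n" "b < n" "a \<noteq> b" "a' < n" "b' < n" "a' \<noteq> b'"
    and "pair_label n l a b = pair_label n l a' b'"
  shows "a = a' \<and> b = b'"
proof -
  have w: "width n a b = width n a' b'"
    and "left_distance n l a = left_distance n l a' \<or> right_distance n l a = right_distance n l a'"
    using assms(8) by (auto simp: pair_label_def split: if_splits)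
  then have "a = a'"
    using assms(1-7) by (auto simp: left_distance_def right_distance_def split: if_splits)
  then show ?thesis
    using w assms(1-7) by (auto simp: width_def split: if_splits)
qed

lemma arc_disjoint: "cyc a b c \<Longrightarrow> i \<in> arc a b \<Longrightarrow> i \<notin> arc b c"
  unfolding arc_def cyc_def by auto

lemma width_less: "cyc a b c \<Longrightarrow> a < n \<Longrightarrow> c < n \<Longrightarrow> b < n \<Longrightarrow> width n a b < width n a c"
  unfolding cyc_def width_def by auto

text \<open>Going left from a point of the arc from \<open>a\<close> to \<open>a'\<close>, circle
  \<open>a\<close> is met before \<open>b\<close>, which lies beyond it.\<close>

lemma left_distance_less:
  assumes "cyc b a a'" "l \<in> arc a a'" "l < n" "a < n" "b < n"
  shows "left_distance n l a < left_distance n l b"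
proof -
  have "a \<noteq> a'" using assms(1) by (auto simp: cyc_def)
  then show ?thesis
    using assms unfolding cyc_def left_distance_def by (cases "a < a'") (auto simp: arc_iff)
qed

text \<open>If the stretch from \<open>b\<close> to \<open>a\<close> avoids \<open>l\<close>, then
  going right from \<open>l\<close> one meets \<open>b\<close> before \<open>a\<close>. For
  \<open>a = l\<close> the formula would give 0 rather than a full turn.\<close>

lemma right_distance_less:
  assumes "l \<notin> arc b a" "a \<noteq> b" "a \<noteq> l" "l < n" "a < n" "b < n"
  shows "right_distance n l b < right_distance n l a"
  using assms unfolding right_distance_def by (cases "b < a") (auto simp: arc_iff)

text \<open>This is where the form of the triple matters: in each of the five positions recutting
  must lower the label whenever the second label was lower.\<close>

lemma exchange_label:
  assumes n: "l < n" "a < n" "a' < n" "b < n" "b' < n"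
    and lt: "pair_label n l b b' < pair_label n l a a'"
    and c: "c = b \<and> c' = b' \<or> b = a \<and> cyc a a' b' \<and> c = a' \<and> c' = b' \<or>
     b = a' \<and> cyc a a' b' \<and> c = a \<and> c' = b' \<or> b' = a \<and> cyc b a a' \<and> c = b \<and> c' = a' \<or>
     b' = a' \<and> cyc b a a' \<and> c = b \<and> c' = a"
  shows "pair_label n l c c' < pair_label n l a a'"
proof -
  consider "c = b \<and> c' = b'" | "b = a" "cyc a a' b'" "c = a'" "c' = b'" | "b = a'" "cyc a a' b'" "c = a" "c' = b'"
    | "b' = a" "cyc b a a'" "c = b" "c' = a'" | "b' = a'" "cyc b a a'" "c = b" "c' = a"
    using c by blast
  then show ?thesis
  proof cases
    case 1
    then show ?thesis using lt by simp
  next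
    case 2
    have lt': "pair_label n l a b' < pair_label n l a a'" using lt 2 by simp
    have mem: "l \<in> arc a b' \<longleftrightarrow> l \<in> arc a a' \<or> l \<in> arc a' b'" using arc_split[OF 2(2)] by simp
    \<comment> \<open>Both start at \<open>a\<close> and the second is wider, so it can only have
      the smaller label by crossing \<open>l\<close> where the first does not; then its right part
      crosses \<open>l\<close>.\<close>
    have "\<not> width n a b' < width n a a'" using width_less[OF 2(2), of n] n by simp
    then have "l \<notin> arc a a'" "l \<in> arc a' b'"
      using lt' mem unfolding pair_label_def by (auto split: if_split_asm)
    then show ?thesis unfolding 2(3,4) pair_label_def by simp
  next
    case 3
    have "a \<noteq> a'" using 3(2) by (auto simp: cyc_def)
    have lt': "pair_label n l a' b' < pair_label n l a a'" using lt 3 by simp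
    have mem: "l \<in> arc a b' \<longleftrightarrow> l \<in> arc a a' \<or> l \<in> arc a' b'" using arc_split[OF 3(2)] by simp
    have "l \<notin> arc a a'"
      using lt' arc_disjoint[OF 3(2), of l] unfolding pair_label_def by (auto split: if_split_asm)
    \<comment> \<open>Otherwise neither crosses \<open>l\<close>, and the second starts farther to
      the right, contrary to its smaller label. So the spanning rectangle crosses
      \<open>l\<close>.\<close>
    moreover have "l \<in> arc a' b'"
    proof (rule ccontr)
      assume l: "l \<notin> arc a' b'"
      then have "a' \<noteq> l" using 3(2) by (auto simp: cyc_def arc_def)
      then have "right_distance n l a < right_distance n l a'"
        using right_distance_less[of l a a' n] \<open>l \<notin> arc a a'\<close> \<open>a \<noteq> a'\<close> n by simp
      then show False using lt' l \<open>l \<notin> arc a a'\<close> unfolding pair_label_def by simp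
    qed
    ultimately show ?thesis using mem unfolding 3(3,4) pair_label_def by simp
  next
    case 4
    have "b \<noteq> a" "a \<noteq> a'" using 4(2) by (auto simp: cyc_def)
    have lt': "pair_label n l b a < pair_label n l a a'" using lt 4 by simp
    have mem: "l \<in> arc b a' \<longleftrightarrow> l \<in> arc b a \<or> l \<in> arc a a'" using arc_split[OF 4(2)] by simp
    \<comment> \<open>If the first crossed \<open>l\<close>, the second, lying to its left, would
      not. Hence the new rectangle either crosses \<open>l\<close> or starts nearer to it on the
      right.\<close>
    have l: "l \<notin> arc a a'"
      using lt' arc_disjoint[OF 4(2), of l] unfolding pair_label_def by (auto split: if_split_asm)
    then have "a \<noteq> l" using \<open>a \<noteq> a'\<close> by (auto simp: arc_def)
    then have "l \<notin> arc b a \<Longrightarrow> right_distance n l b < right_distance n l a"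
      using right_distance_less[of l b a n] \<open>b \<noteq> a\<close> n by simp
    then show ?thesis using mem l unfolding 4(3,4) pair_label_def by simp
  next
    case 5
    have "b \<noteq> a" "a \<noteq> a'" using 5(2) by (auto simp: cyc_def)
    have lt': "pair_label n l b a' < pair_label n l a a'" using lt 5 by simp
    have mem: "l \<in> arc b a' \<longleftrightarrow> l \<in> arc b a \<or> l \<in> arc a a'" using arc_split[OF 5(2)] by simp
    \<comment> \<open>Otherwise both cross \<open>l\<close> and the second, starting farther left,
      has the larger label. So the left part crosses \<open>l\<close> or starts nearer to it on the
      right.\<close>
    have l: "l \<notin> arc a a'"
    proof
      assume "l \<in> arc a a'"
      then show False
        using lt' mem left_distance_less[OF 5(2), of l n] n unfolding pair_label_def by simp
    qed
    then have "a \<noteq> l" using \<open>a \<noteq> a'\<close> by (auto simp: arc_def)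
    then have "l \<notin> arc b a \<Longrightarrow> right_distance n l b < right_distance n l a"
      using right_distance_less[of l b a n] \<open>b \<noteq> a\<close> n by simp
    then show ?thesis using l unfolding 5(3,4) pair_label_def by simp
  qed
qed

lemma left_distance_inj: "left_distance n l a = left_distance n l p \<Longrightarrow> l < n \<Longrightarrow> a < n \<Longrightarrow> p < n \<Longrightarrow> a = p"
  and right_distance_inj: "right_distance n l a = right_distance n l p \<Longrightarrow> l < n \<Longrightarrow> a < n \<Longrightarrow> p < n \<Longrightarrow> a = p"
  by (auto simp: left_distance_def right_distance_def split: if_splits)

lemma pair_label_same_left:
  assumes n: "l < n" "a < n" "e < n" "p < n" "p' < n" "a \<noteq> e" "p \<noteq> p'"
    and lt: "pair_label n l a e < pair_label n l p p'"
    and eq: "(fst (pair_label n l p p'), fst (snd (pair_label n l p p'))) =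
      (fst (pair_label n l a e), fst (snd (pair_label n l a e)))"
  shows "p = a \<and> cyc a e p'"
proof -
  have "p = a"
    using eq left_distance_inj[of n l a p] right_distance_inj[of n l a p] n
    by (auto simp: pair_label_def split: if_split_asm)
  moreover have "width n a e < width n p p'"
    using lt eq by (cases "l \<in> arc a e"; cases "l \<in> arc p p'") (simp_all add: pair_label_def)
  ultimately have "p = a" "width n a e < width n a p'" by auto
  then show ?thesis
    using n unfolding width_def cyc_def by (cases "a < e"; cases "a < p'") auto
qed

text \<open>Circle \<open>a\<close> is met on the way left from \<open>l\<close> to
  \<open>p\<close>, so it runs strictly inside the arc.\<close>

lemma left_distance_cyc:
  assumes "left_distance n l a < left_distance n l p" "l \<in> arc p p'" "l < n" "a < n" "p < n" "p' < n" "p \<noteq> p'"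
  shows "cyc p a p'"
  using assms unfolding left_distance_def cyc_def arc_iff[OF \<open>p \<noteq> p'\<close>]
  by (cases "a \<le> l"; cases "p \<le> l"; cases "p < p'") auto

text \<open>Circle \<open>a\<close> is met on the way right from \<open>l\<close> before
  \<open>p\<close>, and the arc starting at \<open>p\<close> does not get past \<open>l\<close> to
  reach it.\<close>

lemma right_distance_arc:
  assumes "right_distance n l a < right_distance n l p" "l \<notin> arc p p'" "l < n" "a < n" "p < n" "p' < n" "p \<noteq> p'"
  shows "a \<notin> arc p p'"
  using assms unfolding right_distance_def arc_iff[OF \<open>p \<noteq> p'\<close>]
  by (cases "l \<le> a"; cases "l \<le> p"; cases "p < p'") auto

section \<open>Labels of covers and the descent condition\<close>

context grid
begin

lemma step_bounds:
  assumes "step y a b x"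
  shows "a < n" "b < n" "a \<noteq> b" "row (fst y) a < n" "row (fst y) b < n" "row (fst y) a \<noteq> row (fst y) b"
    "fst y \<in> generators n" "fst x \<in> generators n"
proof -
  show ab: "a < n" "b < n" "a \<noteq> b" using assms by (auto simp: step_def vacant_def)
  show gen: "fst y \<in> generators n" "fst x \<in> generators n" using assms by (auto simp: step_def G_iff)
  show "row (fst y) a < n" "row (fst y) b < n" using row_less[OF gen(1)] ab by auto
  show "row (fst y) a \<noteq> row (fst y) b" using inj_on_row[OF gen(1)] ab by (auto simp: inj_on_def)
qed

lemma step_row: "step y a b x \<Longrightarrow> i < n \<Longrightarrow> row (fst x) i = swap a b (row (fst y)) i"
  by (simp add: step_def)

lemma step_element_rectangles:
  assumes st: "step y a b x"
  shows "rect_chain n (row (fst y)) a b \<in> element_rectangles n Xs Os x y"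
proof -
  let ?s = "row (fst y)" and ?R = "rect_chain n (row (fst y)) a b"
  let ?w = "width n a b" and ?h = "width n (?s b) (?s a)"
  note b = step_bounds[OF st]
  have R: "?R \<in> doms x y" and v: "vacant {..<n} ?s a b" using st by (auto simp: step_def)
  have vac: "\<not> cyc (?s b) (?s u) (?s a)" if "u < n" "cyc a u b" for u
    using v that by (auto simp: vacant_def)
  have "block_interior_points n a (?s b) ?w ?h \<inter> (fst x \<union> fst y) = {}"
  proof (intro equals0I)
    fix p assume p: "p \<in> block_interior_points n a (?s b) ?w ?h \<inter> (fst x \<union> fst y)"
    obtain i j where ij: "p = (i, j)" by (cases p)
    then have c: "i < n" "cyc a i b" "cyc (?s b) j (?s a)"
      using p block_interior_points_iff[of a n b ?s i j] b by auto
    then have "i \<noteq> a" "i \<noteq> b" by (auto simp: cyc_def)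
    then have "j = ?s i"
      using p ij c(1) mem_generator[OF b(7)] mem_generator[OF b(8)] step_row[OF st c(1)] by auto
    then show False using vac c by blast
  qed
  moreover have "{p. ?R p = 1} = block_components n a (?s b) ?w ?h"
    using block_components_rectangle[of a n b ?s] b by (auto simp: rect_chain_def)
  moreover have "0 < ?w" "?w < n" "0 < ?h" "?h < n"
    using width_bounds b by auto
  moreover have "?R \<in> domains n (fst x) (fst y)" using R by (simp add: element_domains_def)
  moreover have "\<forall>p. ?R p \<in> {0, 1}" by (simp add: rect_chain_def)
  ultimately have "?R \<in> empty_rectangles n (fst x) (fst y)"
    using b unfolding empty_rectangles_def by blast
  then show ?thesis using R by (simp add: element_rectangles_def)
qed

lemma cover_label_step:
  assumes st: "step y a b x" and l: "l < n"
  shows "cover_label n Xs Os l y x = pair_label n l a b"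
proof -
  have "(THE R. R \<in> element_rectangles n Xs Os x y) = rect_chain n (row (fst y)) a b"
    using step_element_rectangles[OF st] dom_unique
    unfolding element_rectangles_def by (intro the_equality) blast+
  then show ?thesis
    using rect_triple_rect_chain[OF l, of a b "row (fst y)"] step_bounds[OF st] by (simp add: cover_label_def)
qed

lemma step_unique:
  assumes "step y a b x" "step y a b z"
  shows "x = z"
proof -
  have "(\<lambda>p. 0 :: int) \<in> doms x z"
    using dom_diff[of "rect_chain n (row (fst y)) a b" x y "rect_chain n (row (fst y)) a b" z] assms
    by (simp add: step_def)
  then show ?thesis using dom_0_eq[of x z] assms by (simp add: step_def)
qed

lemma cover_label_inj:
  assumes l: "l < n" and "covered_by G le y x" "covered_by G le y z"
    and eq: "cover_label n Xs Os l y x = cover_label n Xs Os l y z"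
  shows "x = z"
proof -
  obtain a b a' b' where st: "step y a b x" "step y a' b' z"
    using assms(2,3) by (auto simp: covered_by_iff)
  have "a = a' \<and> b = b'"
    using pair_label_inj[of l n a b a' b'] l step_bounds[OF st(1)] step_bounds[OF st(2)]
      eq cover_label_step[OF st(1) l] cover_label_step[OF st(2) l] by simp
  then show ?thesis using step_unique st by blast
qed

text \<open>Two successive rectangles on the same pair of columns would fill an annulus, hence contain
  a marking.\<close>

lemma steps_not_same_pair:
  assumes st: "step y a a' z" "step z b b' x"
  shows "{a, a'} \<noteq> {b, b'}"
proof
  assume eq: "{a, a'} = {b, b'}"
  let ?s = "row (fst y)" and ?t = "row (fst z)"
  let ?R = "rect_chain n ?s a a'" and ?Q = "rect_chain n ?t b b'"
  note A = step_bounds[OF st(1)]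
  have t: "?t a = ?s a'" "?t a' = ?s a" using step_row[OF st(1)] A by auto
  have X: "D p = 0" if "D \<in> doms u v" "p \<in> Xs ` {..<n}" for D p u v
    using that by (auto simp: dom_iff)
  have R: "?R \<in> doms z y" "?Q \<in> doms x z" using st by (auto simp: step_def)
  consider "b = a" "b' = a'" | "b = a'" "b' = a" using eq by (auto simp: doubleton_eq_iff)
  then show False
  proof cases
    case 1
    obtain j where j: "j < n" "(a, j) \<in> Xs ` {..<n}" using ex_X_col[OF A(1)] by blast
    have "?R (a, j) = 1 \<or> ?Q (a, j) = 1"
      using A j t unfolding 1 by (auto simp: rect_chain_eq arc_iff)
    then show False using X[OF R(1) j(2)] X[OF R(2) j(2)] by simp
  next
    case 2
    obtain i where i: "i < n" "(i, ?s a') \<in> Xs ` {..<n}" using ex_X_row[OF A(5)] by blast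
    have "?R (i, ?s a') = 1 \<or> ?Q (i, ?s a') = 1"
      using A i t unfolding 2 by (auto simp: rect_chain_eq arc_iff)
    then show False using X[OF R(1) i(2)] X[OF R(2) i(2)] by simp
  qed
qed

text \<open>The recut rectangle lies in the union of the two, so its chain is at most their sum and
  can be cut off first without leaving the interval.\<close>

lemma cover_label_descent:
  assumes l: "l < n" and "covered_by G le y z" "covered_by G le z x"
    and lt: "cover_label n Xs Os l z x < cover_label n Xs Os l y z"
  shows "\<exists>z'. covered_by G le y z' \<and> le z' x \<and> cover_label n Xs Os l y z' < cover_label n Xs Os l y z"
proof -
  obtain a a' b b' where st: "step y a a' z" "step z b b' x"
    using assms(2,3) by (auto simp: covered_by_iff)
  let ?s = "row (fst y)" and ?t = "row (fst z)"
  let ?R = "rect_chain n ?s a a'" and ?Q = "rect_chain n ?t b b'"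
  note A = step_bounds[OF st(1)] and B = step_bounds[OF st(2)]
  have t: "?t i = swap a a' ?s i" if "i < n" for i using step_row[OF st(1) that] .
  have v: "vacant {..<n} ?s a a'" "vacant {..<n} ?t b b'" using st by (auto simp: step_def)
  \<comment> \<open>The rows of \<open>z\<close> agree with the swapped map only on columns below
    \<open>n\<close>, so vacancy and rectangle have to be transferred.\<close>
  have v': "vacant {..<n} (swap a a' ?s) b b'"
    using v(2) t unfolding vacant_def by auto
  have rect: "rectangle ?t b b' = rectangle (swap a a' ?s) b b'"
    using t[OF B(1)] t[OF B(2)] by (simp add: rectangle_def)
  obtain c c' where c: "vacant {..<n} ?s c c'" "rectangle ?s c c' \<subseteq> rectangle ?s a a' \<union> rectangle ?t b b'"
    and cases: "c = b \<and> c' = b' \<or> b = a \<and> cyc a a' b' \<and> c = a' \<and> c' = b' \<or>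
     b = a' \<and> cyc a a' b' \<and> c = a \<and> c' = b' \<or> b' = a \<and> cyc b a a' \<and> c = b \<and> c' = a' \<or>
     b' = a' \<and> cyc b a a' \<and> c = b \<and> c' = a"
    using exchange[OF inj_on_row[OF A(7)] v(1) v' steps_not_same_pair[OF st]] unfolding rect by blast
  have "?R \<in> doms z y" "?Q \<in> doms x z" "x \<in> G" "y \<in> G" using st by (auto simp: step_def)
  then have D: "x \<in> G" "y \<in> G" "(\<lambda>p. ?Q p + ?R p) \<in> doms x y" using dom_add by auto
  have le: "rect_chain n ?s c c' p \<le> ?Q p + ?R p" for p
    using c(2) by (auto simp: rect_chain_def)
  from stepI[OF D c(1) le] obtain z' where z': "step y c c' z'" "le z' x" by blast
  have "pair_label n l c c' < pair_label n l a a'"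
    using lt cover_label_step[OF st(1) l] cover_label_step[OF st(2) l] exchange_label[OF l _ _ _ _ _ cases] A B
    by simp
  then show ?thesis
    using z' cover_label_step[OF st(1) l] cover_label_step[OF z'(1) l] covered_by_iff by metis
qed

end

section \<open>Sorted chains start with the least label\<close>

locale grid_pair = grid +
  fixes l a e :: nat
  assumes l: "l < n" and a: "a < n" and e: "e < n" and ae: "a \<noteq> e"
begin

text \<open>A column of the rectangle on \<open>a\<close>, \<open>e\<close> in which sorted chains
  with larger labels are shown to leave a cell free.\<close>

definition col :: nat where
  "col = (if l \<in> arc a e then l else a)"

text \<open>Drops the thickness; for a given \<open>l\<close> what remains determines the left
  column.\<close>

definition label_key :: "nat \<times> nat \<times> nat \<Rightarrow> nat \<times> nat" where
  "label_key t = (fst t, fst (snd t))"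

text \<open>A condition on the label alone that keeps the rectangle away from \<open>col\<close>. It
  is upward closed, so once it holds in a sorted chain it persists.\<close>

definition off :: "nat \<times> nat \<times> nat \<Rightarrow> bool" where
  "off t \<longleftrightarrow> (if l \<in> arc a e then 0 < fst t else label_key (pair_label n l a e) < label_key t)"

lemma label_key_mono: "t \<le> t' \<Longrightarrow> label_key t \<le> label_key t'"
  by (cases t; cases t') (auto simp: label_key_def)

lemma off_mono: "off t \<Longrightarrow> t \<le> t' \<Longrightarrow> off t'"
  using label_key_mono[of t t'] by (cases t; cases t') (auto simp: off_def)

lemma off_arc:
  assumes "off (pair_label n l p p')" "p < n" "p' < n" "p \<noteq> p'"
  shows "col \<notin> arc p p'"
proof (cases "l \<in> arc a e")
  case True
  then show ?thesis using assms(1) by (auto simp: off_def col_def pair_label_def split: if_split_asm)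
next
  case False
  then have "l \<notin> arc p p'" "right_distance n l a < right_distance n l p"
    using assms(1) by (auto simp: off_def pair_label_def label_key_def split: if_split_asm)
  then show ?thesis using right_distance_arc[of n l a p p'] assms False l a by (simp add: col_def)
qed

text \<open>Such a label occurs only if both rectangles cross \<open>l\<close>; the larger key then
  puts \<open>p\<close> farther left than \<open>a\<close>.\<close>

lemma not_off_cyc:
  assumes "label_key (pair_label n l a e) < label_key (pair_label n l p p')"
    and "\<not> off (pair_label n l p p')" "p < n" "p' < n" "p \<noteq> p'"
  shows "cyc p a p'"
proof -
  have "l \<in> arc a e" using assms(1,2) unfolding off_def by presburger
  then have "l \<in> arc p p'" using assms(2) by (simp add: off_def pair_label_def split: if_split_asm)
  then have "left_distance n l a < left_distance n l p"
    using assms(1) \<open>l \<in> arc a e\<close> by (auto simp: label_key_def pair_label_def)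
  then show ?thesis using left_distance_cyc \<open>l \<in> arc p p'\<close> l a assms by blast
qed

lemma col_less: "col < n"
  using l a by (simp add: col_def)

lemma chain_step:
  assumes "z # z' # c \<in> maximal_chains G le z b" "D \<in> doms b z"
  obtains p p' where "step z p p' z'" "z' # c \<in> maximal_chains G le z' b"
    "(\<lambda>q. D q - rect_chain n (row (fst z)) p p' q) \<in> doms b z'"
    "cover_label n Xs Os l z z' = pair_label n l p p'"
proof -
  have "covered_by G le z z'" and c: "z' # c \<in> maximal_chains G le z' b"
    using assms(1) maximal_chains_Cons by auto
  then obtain p p' where st: "step z p p' z'" by (auto simp: covered_by_iff)
  then have "(\<lambda>q. D q - rect_chain n (row (fst z)) p p' q) \<in> doms b z'"
    using dom_diff[OF assms(2)] by (simp add: step_def)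
  then show ?thesis using that st c cover_label_step[OF st l] by blast
qed

lemma chain_end:
  assumes "[z] \<in> maximal_chains G le z b" "D \<in> doms b z"
  shows "D = (\<lambda>_. 0)"
  using assms dom_unique[OF _ dom_0] by (auto simp: maximal_chains_def)

lemma zero_if_off:
  assumes "z # c \<in> maximal_chains G le z b" "D \<in> doms b z"
    and "\<forall>t \<in> set (labeling (cover_label n Xs Os l) (z # c)). off t"
  shows "D (col, j) = 0"
  using assms
proof (induction c arbitrary: z D)
  case Nil
  then show ?case using chain_end[OF Nil(1,2)] by simp
next
  case (Cons z' c)
  from chain_step[OF Cons.prems(1,2)] obtain p p' where
    st: "step z p p' z'" "z' # c \<in> maximal_chains G le z' b"
    and D: "(\<lambda>q. D q - rect_chain n (row (fst z)) p p' q) \<in> doms b z'"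
    and lab: "cover_label n Xs Os l z z' = pair_label n l p p'" .
  have "col \<notin> arc p p'"
    using Cons.prems(3) step_bounds[OF st(1)] by (intro off_arc) (auto simp: labeling_Cons lab)
  then have "rect_chain n (row (fst z)) p p' (col, j) = 0" by (simp add: rect_chain_eq)
  moreover have "D (col, j) - rect_chain n (row (fst z)) p p' (col, j) = 0"
    using Cons.IH[OF st(2) D] Cons.prems(3) by (simp add: labeling_Cons)
  ultimately show ?case by simp
qed

text \<open>While rectangles still meet \<open>col\<close>, they cross column \<open>a\<close>
  strictly. By vacancy the point there neither moves nor lies in their rows, so the row just below
  it is not covered; afterwards all labels are \<open>off\<close>.\<close>

lemma zero_below_point:
  assumes "z # c \<in> maximal_chains G le z b" "D \<in> doms b z"
    and "sorted (labeling (cover_label n Xs Os l) (z # c))"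
    and "\<forall>t \<in> set (labeling (cover_label n Xs Os l) (z # c)).
      label_key (pair_label n l a e) < label_key t"
  shows "D (col, prd n (row (fst z) a)) = 0"
  using assms
proof (induction c arbitrary: z D)
  case Nil
  then show ?case using chain_end[OF Nil(1,2)] by simp
next
  case (Cons z' c)
  from chain_step[OF Cons.prems(1,2)] obtain p p' where
    st: "step z p p' z'" "z' # c \<in> maximal_chains G le z' b"
    and D: "(\<lambda>q. D q - rect_chain n (row (fst z)) p p' q) \<in> doms b z'"
    and lab: "cover_label n Xs Os l z z' = pair_label n l p p'" .
  let ?r = "row (fst z)"
  note B = step_bounds[OF st(1)]
  show ?case
  proof (cases "off (pair_label n l p p')")
    case True
    then have "\<forall>t \<in> set (labeling (cover_label n Xs Os l) (z # z' # c)). off t"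
      using Cons.prems(3) off_mono by (auto simp: labeling_Cons lab)
    then show ?thesis by (rule zero_if_off[OF Cons.prems(1,2)])
  next
    case False
    have cyc: "cyc p a p'"
      using Cons.prems(4) False B by (intro not_off_cyc) (auto simp: labeling_Cons lab)
    then have ne: "a \<noteq> p" "a \<noteq> p'" by (auto simp: cyc_def)
    have "vacant {..<n} ?r p p'" using st(1) by (simp add: step_def)
    then have "\<not> cyc (?r p') (?r a) (?r p)" using cyc a by (auto simp: vacant_def)
    moreover have rne: "?r a \<noteq> ?r p" "?r a \<noteq> ?r p'"
      using inj_on_row[OF B(7)] ne a B by (auto simp: inj_on_def)
    ultimately have "?r a \<notin> arc (?r p') (?r p)" by (auto simp: arc_def)
    then have "prd n (?r a) \<notin> arc (?r p') (?r p)"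
      using arc_prd[of "?r a" n "?r p'" "?r p"] row_less[OF B(7) a] B rne by (auto simp: of_bool_def split: if_splits)
    then have "rect_chain n ?r p p' (col, prd n (?r a)) = 0" by (simp add: rect_chain_eq)
    moreover have "row (fst z') a = ?r a" using step_row[OF st(1) a] ne by simp
    ultimately show ?thesis
      using Cons.IH[OF st(2) D] Cons.prems(3,4) by (simp add: labeling_Cons)
  qed
qed

text \<open>The chain first cuts rectangles off at column \<open>a\<close>, all of them too wide to move the point
  in column \<open>e\<close>, hence not reaching down to its row; then rectangles crossing column \<open>a\<close>, which
  avoid the point there; and finally rectangles not meeting the column \<open>col\<close>.\<close>

lemma ex_zero:
  assumes "z # c \<in> maximal_chains G le z b" "D \<in> doms b z" "z \<in> G"
    and "sorted (labeling (cover_label n Xs Os l) (z # c))"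
    and "\<forall>t \<in> set (labeling (cover_label n Xs Os l) (z # c)). pair_label n l a e < t"
  shows "\<exists>j<n. j \<in> arc (row (fst z) e) (row (fst z) a) \<and> D (col, j) = 0"
  using assms
proof (induction c arbitrary: z D)
  case Nil
  have gen: "fst z \<in> generators n" using Nil by (simp add: G_iff)
  have "row (fst z) e < n" "row (fst z) a \<noteq> row (fst z) e"
    using row_less[OF gen e] inj_on_row[OF gen] a e ae by (auto simp: inj_on_def)
  then show ?case using chain_end[OF Nil.prems(1,2)] by (auto simp: arc_def)
next
  case (Cons z' c)
  from chain_step[OF Cons.prems(1,2)] obtain p p' where
    st: "step z p p' z'" "z' # c \<in> maximal_chains G le z' b"
    and D: "(\<lambda>q. D q - rect_chain n (row (fst z)) p p' q) \<in> doms b z'"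
    and lab: "cover_label n Xs Os l z z' = pair_label n l p p'" .
  let ?r = "row (fst z)"
  note B = step_bounds[OF st(1)]
  have re: "?r e < n" "?r a < n" "?r a \<noteq> ?r e"
    using row_less[OF B(7)] inj_on_row[OF B(7)] a e ae by (auto simp: inj_on_def)
  show ?case
  proof (cases "label_key (pair_label n l p p') = label_key (pair_label n l a e)")
    case True
    then have "p = a" and cyc: "cyc a e p'"
      using pair_label_same_left[of l n a e p p'] Cons.prems(5) l a e ae B
      by (auto simp: labeling_Cons lab label_key_def)
    then have pne: "e \<noteq> p'" by (auto simp: cyc_def)
    have "vacant {..<n} ?r a p'" using st(1) \<open>p = a\<close> by (simp add: step_def)
    then have "\<not> cyc (?r p') (?r e) (?r a)" using cyc e by (auto simp: vacant_def)
    moreover have "?r e \<noteq> ?r p'" using inj_on_row[OF B(7)] pne e B by (auto simp: inj_on_def)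
    ultimately have rows: "cyc (?r e) (?r p') (?r a)"
      using not_cyc[of "?r p'" "?r e" "?r a"] re B \<open>p = a\<close> by auto
    have z': "row (fst z') a = ?r p'" "row (fst z') e = ?r e" "z' \<in> G"
      using step_row[OF st(1)] a e ae pne \<open>p = a\<close> st(1) by (auto simp: step_def)
    \<comment> \<open>The point in column \<open>a\<close> has dropped to the row of
      \<open>p'\<close>, so the inductive zero lies below the rectangle just cut off.\<close>
    obtain j where j: "j < n" "j \<in> arc (?r e) (?r p')"
      "D (col, j) - rect_chain n ?r p p' (col, j) = 0"
      using Cons.IH[OF st(2) D z'(3)] Cons.prems(4,5) z' by (auto simp: labeling_Cons)
    have "j \<notin> arc (?r p') (?r p)" using arc_disjoint[OF rows j(2)] \<open>p = a\<close> by simp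
    then have "rect_chain n ?r p p' (col, j) = 0" by (simp add: rect_chain_eq)
    moreover have "j \<in> arc (?r e) (?r a)" using arc_split[OF rows] j by simp
    ultimately show ?thesis using j by auto
  next
    case False
    have "pair_label n l a e < pair_label n l p p'" using Cons.prems(5) by (simp add: labeling_Cons lab)
    then have "label_key (pair_label n l a e) < label_key (pair_label n l p p')"
      using label_key_mono[of "pair_label n l a e" "pair_label n l p p'"] False by (simp add: less_le)
    moreover have "label_key (pair_label n l p p') \<le> label_key t"
      if "t \<in> set (labeling (cover_label n Xs Os l) (z # z' # c))" for t
      using Cons.prems(4) that by (intro label_key_mono) (auto simp: labeling_Cons lab)
    ultimately have "\<forall>t \<in> set (labeling (cover_label n Xs Os l) (z # z' # c)).
      label_key (pair_label n l a e) < label_key t"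
      using order.strict_trans2 by blast
    then have "D (col, prd n (?r a)) = 0"
      by (rule zero_below_point[OF Cons.prems(1,2,4)])
    moreover have "prd n (?r a) \<in> arc (?r e) (?r a)"
      using re by (auto simp: arc_iff prd_if)
    ultimately show ?thesis using prd_less[OF re(2)] by blast
  qed
qed

end

context grid
begin

text \<open>If \<open>z'\<close> had a smaller label, all labels of the chain would exceed it, and
  \<open>ex_zero\<close> gives a cell of its rectangle where the domain from \<open>x\<close> to
  \<open>y\<close> is 0. But \<open>z'\<close> below \<open>x\<close> makes that domain at least 1
  there.\<close>

lemma cover_label_sorted_least:
  assumes l: "l < n" and c: "y # z # c \<in> maximal_chains G le y x"
    and sorted: "sorted (labeling (cover_label n Xs Os l) (y # z # c))"
    and cov: "covered_by G le y z'" and le: "le z' x"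
  shows "cover_label n Xs Os l y z \<le> cover_label n Xs Os l y z'"
proof (rule ccontr)
  assume "\<not> ?thesis"
  then have lt: "cover_label n Xs Os l y z' < cover_label n Xs Os l y z" by simp
  obtain a e where st: "step y a e z'" using cov by (auto simp: covered_by_iff)
  note A = step_bounds[OF st]
  interpret grid_pair n Xs Os l a e
    by unfold_locales (use l A in auto)
  let ?R = "rect_chain n (row (fst y)) a e"
  obtain D where D: "D \<in> doms x z'" "\<And>p. 0 \<le> D p" using le by (auto elim!: leE)
  have R: "?R \<in> doms z' y" "y \<in> G" using st by (auto simp: step_def)
  have lab: "\<forall>t \<in> set (labeling (cover_label n Xs Os l) (y # z # c)). pair_label n l a e < t"
    using sorted lt cover_label_step[OF st l] by (auto simp: labeling_Cons intro: order.strict_trans2)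
  obtain j where j: "j < n" "j \<in> arc (row (fst y) e) (row (fst y) a)" "D (col, j) + ?R (col, j) = 0"
    using ex_zero[OF c dom_add[OF D(1) R(1)] R(2) sorted lab] by auto
  have "col \<in> arc a e" using A by (auto simp: col_def arc_def)
  then have "?R (col, j) = 1" using j(1,2) col_less by (simp add: rect_chain_eq)
  then show False using j(3) D(2)[of "(col, j)"] by simp
qed

lemma labeled_ranked_poset_grid:
  assumes "l < n"
  shows "labeled_ranked_poset G le grid_rank (cover_label n Xs Os l)"
  by unfold_locales
    (use assms cover_label_inj cover_label_descent cover_label_sorted_least in blast)+

end

theorem theorem4p1:
  fixes n l :: nat and Xs Os :: "nat \<Rightarrow> nat \<times> nat" and x y :: grid_element
  assumes "grid_diagram n Xs Os"
    and "l < n"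
    and "x \<in> grid_elements n" and "y \<in> grid_elements n"
  shows "EL_shelling (closed_interval (grid_elements n) (grid_le n Xs Os) y x)
           (grid_le n Xs Os) (cover_label n Xs Os l)"
proof -
  interpret grid n Xs Os by unfold_locales (rule assms)
  interpret labeled_ranked_poset G le grid_rank "cover_label n Xs Os l"
    by (rule labeled_ranked_poset_grid[OF assms(2)])
  show ?thesis by (rule EL_shelling_closed_interval[OF assms(4,3)])
qed

end
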